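(* Let $X$ be a continuous strong Markov process on a compact metric space $(E\cup\{\partial\},\rho)$, absorbed at $\partial$, with $\mathbb{P}_x(t<\tau_\partial)>0$ for all $x\in E$ and $t\geq0$. Assume that there is a constant $t_1>0$ such that the following three conditions hold. (1) There is a constant $C>0$ such that, for all bounded measurable $f:E\cup\{\partial\}\to\mathbb{R}$, $\|\nabla P_{t_1}f\|_\infty\leq C\|f\|_\infty$. (2) There exist a compact subset $K$ of $E$ and a constant $C'>0$ such that, for all $x\in E$, $\mathbb{P}_x(T_K\leq t_1<\tau_\partial)\geq C'\rho_\partial(x)$. (3) For all $x,y\in E$ and all $r>0$, $\mathbb{P}_x(X_s\in B(y,r),\ \forall s\in[t_1,2t_1])>0$. Then Condition (A) is satisfied, and hence there exist a probability measure $\alpha$ on $E$ and constants $B_0,\gamma_0>0$ such that, for every initial distribution $\mu$ on $E$, $$\|\mathbb{P}_\mu(X_t\in\cdot\mid t<\tau_\partial)-\alpha(\cdot)\|_{TV}\leq B_0e^{-\gamma_0 t},\qquad\forall t\geq0.$$ Moreover, there exist two constants $B,\gamma>0$ such that, for any initial distributions $\mu_1$ and $\mu_2$ on $E$ and all $t\geq 0$, $$\left\|\mathbb{P}_{\mu_1}(X_t\in\cdot\mid t<\tau_\partial)-\mathbb{P}_{\mu_2}(X_t\in\cdot\mid t<\tau_\partial)\right\|_{TV}\leq\frac{Be^{-\gamma t}}{\mu_1(\rho_\partial)\vee\mu_2(\rho_\partial)}\,\|\mu_1-\mu_2\|_{TV}.$$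
   Context: $X=(X_t)_{t\geq0}$ is a time-homogeneous Markov process in $E\cup\{\partial\}$, $\partial\notin E$, where $E\cup\{\partial\}$ is a compact metric space with metric $\rho$ and Borel $\sigma$-field; $X$ is strong Markov with continuous paths. The point $\partial$ is absorbing and $\tau_\partial=\inf\{t\geq0:X_t=\partial\}$. $\mathbb{P}_x$ (resp. $\mathbb{P}_\mu$) is the law of $X$ with initial position $x$ (resp. initial distribution $\mu$, a probability measure on $E$). $P_tf(x)=\mathbb{E}_x(f(X_t)\mathbf{1}_{t<\tau_\partial})$ is the Dirichlet semigroup, and $$\|\nabla P_tf\|_\infty:=\sup_{x,y\in E\cup\{\partial\},\,x\neq y}\frac{|P_tf(x)-P_tf(y)|}{\rho(x,y)}.$$ $\rho_\partial(x)=\rho(x,\partial)$, $T_K=\inf\{t\geq0:X_t\in K\}$, $B(y,r)$ is the ball of radius $r$ centered at $y$, $\mu(g)=\int g\,d\mu$, $a\vee b=\max(a,b)$, and $\|\cdot\|_{TV}$ is the total variation norm on finite signed measures. Condition (A): there exist $t_0,c_1,c_2>0$ and a probability measure $\nu$ on $E$ such that (A1) for all $x\in E$, $\mathbb{P}_x(X_{t_0}\in\cdot\mid t_0<\tau_\partial)\geq c_1\nu(\cdot)$; (A2) for all $z\in E$ and all $t\geq0$, $\mathbb{P}_\nu(t<\tau_\partial)\geq c_2\mathbb{P}_z(t<\tau_\partial)$. *)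

theory Defs
  imports "HOL-Probability.Probability"
begin

text \<open>
  The compact metric space \<open>E \<union> {\<partial>}\<close> is a whole type \<open>'a::metric_space\<close> with its Borel
  sets; \<open>cem\<close> is the cemetery \<open>\<partial>\<close>. Only nonnegative time indices of \<open>X\<close> are relevant.
  Random times take values in \<open>ennreal\<close>, with value \<open>\<infinity>\<close> if the event never occurs.
\<close>

definition hitting_time :: "(real \<Rightarrow> 'w \<Rightarrow> 'a) \<Rightarrow> 'a set \<Rightarrow> 'w \<Rightarrow> ennreal" where
  "hitting_time X A \<omega> = (INF t\<in>{t. 0 \<le> t \<and> X t \<omega> \<in> A}. ennreal t)"

abbreviation absorption_time :: "(real \<Rightarrow> 'w \<Rightarrow> 'a) \<Rightarrow> 'a \<Rightarrow> 'w \<Rightarrow> ennreal" where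
  "absorption_time X cem \<equiv> hitting_time X {cem}"

text \<open>
  The time index runs over \<open>[0,\<infinity>]\<close>, so that \<^const>\<open>stopping_time\<close> and
  \<^const>\<open>filtration.pre_sigma\<close> apply to stopping times that may be infinite.
\<close>

definition natural_filtration ::
    "'w set \<Rightarrow> (real \<Rightarrow> 'w \<Rightarrow> 'a::topological_space) \<Rightarrow> ennreal \<Rightarrow> 'w measure" where
  "natural_filtration \<Omega> X t =
     sigma \<Omega> {X s -` B \<inter> \<Omega> | s B. 0 \<le> s \<and> ennreal s \<le> t \<and> B \<in> sets borel}"

lemma filtration_natural_filtration: "filtration \<Omega> (natural_filtration \<Omega> X)"
proof
  fix i j :: ennreal
  show "space (natural_filtration \<Omega> X i) = \<Omega>"
    unfolding natural_filtration_def by (rule space_measure_of) auto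
  assume "i \<le> j"
  then show "sets (natural_filtration \<Omega> X i) \<subseteq> sets (natural_filtration \<Omega> X j)"
    unfolding natural_filtration_def
    by (subst (1 2) sets_measure_of) (auto intro!: sigma_sets_mono' intro: order_trans)
qed

text \<open>
  The strong Markov property is required for the natural filtration only; it is then implied by
  the strong Markov property for any larger filtration. It reads
  \<open>P\<^sub>x (X\<^bsub>T+t\<^esub> \<in> B | \<F>\<^sub>T) = P\<^bsub>X\<^sub>T\<^esub> (X\<^sub>t \<in> B)\<close> almost surely on \<open>{T < \<infinity>}\<close>; constant times \<open>T\<close>
  give the time-homogeneous Markov property. On \<open>{T = \<infinity>}\<close>, an event of \<open>\<F>\<^sub>T\<close>,
  \<open>enn2real T\<close> is a dummy value.
\<close>

locale absorbed_strong_markov =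
  fixes E :: "'a::metric_space set" and cem :: 'a
    and M :: "'w measure" and P :: "'a \<Rightarrow> 'w measure" and X :: "real \<Rightarrow> 'w \<Rightarrow> 'a"
  assumes compact_space: "compact (UNIV :: 'a set)"
    and E_cem: "E \<union> {cem} = UNIV" "cem \<notin> E"
    and E_nonempty: "E \<noteq> {}"
    and P_measurable: "P \<in> borel \<rightarrow>\<^sub>M prob_algebra M"
    and X_measurable: "\<And>t. 0 \<le> t \<Longrightarrow> X t \<in> M \<rightarrow>\<^sub>M borel"
    and initial: "\<And>x. AE \<omega> in P x. X 0 \<omega> = x"
    and continuous_paths: "\<And>\<omega>. \<omega> \<in> space M \<Longrightarrow> continuous_on {0..} (\<lambda>t. X t \<omega>)"
    and absorbing: "\<And>\<omega> s t. \<omega> \<in> space M \<Longrightarrow> 0 \<le> s \<Longrightarrow> s \<le> t \<Longrightarrow> X s \<omega> = cem \<Longrightarrow> X t \<omega> = cem"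
    and strong_markov: "\<And>x T t B. stopping_time (natural_filtration (space M) X) T \<Longrightarrow> 0 \<le> t \<Longrightarrow>
      B \<in> sets borel \<Longrightarrow>
      (AE \<omega> in P x. T \<omega> < \<infinity> \<longrightarrow>
         real_cond_exp (P x)
           (filtration.pre_sigma (space M) (natural_filtration (space M) X) T)
           (indicator {\<omega>\<in>space M. X (enn2real (T \<omega>) + t) \<omega> \<in> B}) \<omega>
         = \<P>(\<omega>' in P (X (enn2real (T \<omega>)) \<omega>). X t \<omega>' \<in> B))"

text \<open>
  Probability measures on \<open>E\<close> are identified with Borel probability measures on \<open>E \<union> {\<partial>}\<close>
  giving mass one to \<open>E\<close>.
\<close>

definition prob_measure_on :: "'a::topological_space set \<Rightarrow> 'a measure \<Rightarrow> bool" where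
  "prob_measure_on E \<mu> \<longleftrightarrow> prob_space \<mu> \<and> sets \<mu> = sets borel \<and> measure \<mu> E = 1"

text \<open>
  In the next definition \<open>Q\<close> is the law of the process: \<open>P x\<close>, or \<open>\<mu> \<bind> P\<close> for the initial
  distribution \<open>\<mu>\<close>.
\<close>

definition conditional_law ::
    "'w measure \<Rightarrow> (real \<Rightarrow> 'w \<Rightarrow> 'a) \<Rightarrow> 'a \<Rightarrow> real \<Rightarrow> 'a set \<Rightarrow> real" where
  "conditional_law Q X cem t A = \<P>(\<omega> in Q. X t \<omega> \<in> A \<bar> ennreal t < absorption_time X cem \<omega>)"

definition dirichlet_semigroup ::
    "('a \<Rightarrow> 'w measure) \<Rightarrow> (real \<Rightarrow> 'w \<Rightarrow> 'a) \<Rightarrow> 'a \<Rightarrow> real \<Rightarrow> ('a \<Rightarrow> real) \<Rightarrow> 'a \<Rightarrow> real" where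
  "dirichlet_semigroup P X cem t f x =
     (\<integral>\<omega>. f (X t \<omega>) * indicator {\<omega>. ennreal t < absorption_time X cem \<omega>} \<omega> \<partial>P x)"

definition gradient_norm :: "('a::metric_space \<Rightarrow> real) \<Rightarrow> ennreal" where
  "gradient_norm g = (SUP (x, y)\<in>{(x, y). x \<noteq> y}. ennreal (\<bar>g x - g y\<bar> / dist x y))"

text \<open>Total variation norm of a finite signed measure, given as a set function on the Borel sets.\<close>

definition tv_norm :: "('a::topological_space set \<Rightarrow> real) \<Rightarrow> real" where
  "tv_norm \<sigma> = Sup {\<Sum>A\<in>\<A>. \<bar>\<sigma> A\<bar> | \<A>. finite \<A> \<and> disjoint \<A> \<and> \<A> \<subseteq> sets borel}"

definition condition_A ::
    "'a::metric_space set \<Rightarrow> 'a \<Rightarrow> ('a \<Rightarrow> 'w measure) \<Rightarrow> (real \<Rightarrow> 'w \<Rightarrow> 'a) \<Rightarrow> bool" where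
  "condition_A E cem P X \<longleftrightarrow>
     (\<exists>t0 c1 c2 \<nu>. 0 < t0 \<and> 0 < c1 \<and> 0 < c2 \<and> prob_measure_on E \<nu> \<and>
        (\<forall>x\<in>E. \<forall>A\<in>sets borel. conditional_law (P x) X cem t0 A \<ge> c1 * measure \<nu> A) \<and>
        (\<forall>z\<in>E. \<forall>t\<ge>0. \<P>(\<omega> in \<nu> \<bind> P. ennreal t < absorption_time X cem \<omega>)
           \<ge> c2 * \<P>(\<omega> in P z. ennreal t < absorption_time X cem \<omega>)))"

end

theory Submission
  imports Defs
begin

text \<open>
  Write \<open>S\<^sub>t(x)\<close> for the probability of survival until time \<open>t\<close> from \<open>x\<close> and \<open>\<rho>(x)\<close> for the distance
  from \<open>x\<close> to the cemetery. The theorem rests on a lower bound and an upper bound that are both linear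
  in \<open>\<rho>\<close>. The gradient estimate, applied to the indicator of \<open>E\<close>, gives \<open>S\<^bsub>t\<^sub>1\<^esub> \<le> C \<rho>\<close>. In the other
  direction, there are a probability measure \<open>\<nu>\<close> on \<open>E\<close> and \<open>a > 0\<close> with

    \<open>P\<^sub>x(X\<^bsub>t\<^sub>0\<^esub> \<in> A) \<ge> a \<rho>(x) \<nu>(A)\<close>, where \<open>t\<^sub>0 = 4 t\<^sub>1\<close>.

  Dividing one by the other yields (A1). The lower bound combines three facts. The gradient estimate
  makes the law of \<open>X\<^sub>s\<close>, \<open>s \<ge> t\<^sub>1\<close>, Lipschitz in the starting point for the total variation distance, and
  for such a kernel every point has a neighbourhood that is a small set for the two-step kernel
  (\<open>local_minorization\<close>). By irreducibility and compactness, a fixed ball is reached from the compact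
  set \<open>K\<close>, and even from a neighbourhood of it, with a probability bounded below
  (\<open>uniformly_reachable\<close>). Finally \<open>K\<close> is hit with a probability of at least \<open>C' \<rho>(x)\<close>; the hitting time
  is discretised, so that the Markov property at fixed times applies (\<open>hit_then_reach\<close>).

  For (A2), the Lipschitz property bounds \<open>sup S\<^bsub>t + t\<^sub>1\<^esub>\<close> by a multiple of the survival probability from
  \<open>\<nu>\<close> plus an arbitrarily small multiple of \<open>sup S\<^sub>t\<close>. The lower bound shows that the survival
  probability from \<open>\<nu>\<close> does not decay faster than geometrically, so that the error terms of this
  recursion are summable (\<open>survival_comparison\<close>).

  Under (A), the process conditioned to survive until a time \<open>T\<close> is an inhomogeneous Markov process
  whose transitions over periods of length \<open>t\<^sub>0\<close> satisfy Doeblin's condition with a constant that does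
  not depend on \<open>T\<close> (\<open>doeblin_minorization\<close>), so conditional laws from different initial points
  approach each other geometrically (\<open>contraction\<close>). Completeness for uniform convergence on Borel sets
  gives the limit \<open>\<alpha>\<close> (\<open>quasi_stationary_limit\<close>). For the dependence on the initial distribution, the
  difference of two conditional laws is an integral against \<open>\<mu>\<^sub>1 - \<mu>\<^sub>2\<close> of a function of size
  \<open>e\<^sup>-\<^sup>\<gamma>\<^sup>t sup S\<^sub>t\<close>, divided by the survival probability from \<open>\<mu>\<^sub>1\<close>, which is at least a multiple of
  \<open>\<mu>\<^sub>1(\<rho>) sup S\<^sub>t\<close> (\<open>\<Phi>_diff_lipschitz\<close>).
\<close>

section \<open>Total variation distance of probability measures\<close>

lemma integral_mono_of_measure_le:
  fixes f :: "'b \<Rightarrow> real"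
  assumes M: "finite_measure M" and N: "finite_measure N" and sets: "sets N = sets M" and c: "0 \<le> c"
    and le: "\<And>A. A \<in> sets M \<Longrightarrow> c * measure N A \<le> measure M A"
    and f: "f \<in> borel_measurable M" and f0: "\<And>x. 0 \<le> f x" and fB: "\<And>x. f x \<le> B"
  shows "c * (\<integral>x. f x \<partial>N) \<le> (\<integral>x. f x \<partial>M)"
proof -
  interpret M: finite_measure M by fact
  interpret N: finite_measure N by fact
  have fN: "f \<in> borel_measurable N" using f by (simp add: measurable_cong_sets[OF sets refl])
  have iM: "integrable M f" and iN: "integrable N f"
    using f0 fB by (auto intro!: M.integrable_const_bound[where B=B] N.integrable_const_bound[where B=B] f fN)
  have le': "scale_measure (ennreal c) N \<le> M"
    using le c sets
    by (subst le_measure)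
      (auto simp: M.emeasure_eq_measure N.emeasure_eq_measure ennreal_mult'[symmetric] intro!: ennreal_leI)
  have "ennreal (c * (\<integral>x. f x \<partial>N)) = ennreal c * (\<integral>\<^sup>+x. ennreal (f x) \<partial>N)"
    using c f0 by (subst nn_integral_eq_integral[OF iN]) (auto simp: ennreal_mult' integral_nonneg_AE)
  also have "\<dots> = (\<integral>\<^sup>+x. ennreal (f x) \<partial>scale_measure (ennreal c) N)"
    using fN by (subst nn_integral_scale_measure) auto
  also have "\<dots> \<le> (\<integral>\<^sup>+x. ennreal (f x) \<partial>M)"
    using le' sets by (intro nn_integral_mono_measure) auto
  also have "\<dots> = ennreal (\<integral>x. f x \<partial>M)"
    using f0 by (subst nn_integral_eq_integral[OF iM]) auto
  finally show ?thesis using f0 by (simp add: integral_nonneg_AE)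
qed

text \<open>
  The layer-cake idea in discrete form: \<open>\<lfloor>n f\<rfloor> / n\<close> is the average of the indicators of the \<open>n\<close>
  level sets \<open>{k \<le> n f}\<close>, so that its two integrals differ by at most \<open>d\<close>, and it approximates \<open>f\<close>
  uniformly up to \<open>1 / n\<close>.
\<close>

lemma integral_diff_le_unit:
  fixes f :: "'b \<Rightarrow> real"
  assumes M: "prob_space M" and N: "prob_space N" and sets: "sets N = sets M"
    and le: "\<And>A. A \<in> sets M \<Longrightarrow> \<bar>measure M A - measure N A\<bar> \<le> d"
    and f: "f \<in> borel_measurable M" and f0: "\<And>x. 0 \<le> f x" and f1: "\<And>x. f x \<le> 1"
  shows "\<bar>(\<integral>x. f x \<partial>M) - (\<integral>x. f x \<partial>N)\<bar> \<le> d"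
proof -
  have d0: "0 \<le> d" using le[of "{}"] by auto
  define F where "F n k = {x\<in>space M. real k \<le> real n * f x}" for n k :: nat
  define g where "g n x = (\<Sum>k\<in>{1..n}. indicator (F n k) x) / real n" for n and x
  have FM: "F n k \<in> sets M" for n k unfolding F_def using f by measurable
  have g: "g n x = real_of_int \<lfloor>real n * f x\<rfloor> / real n" if "x \<in> space M" for n x
  proof -
    have "(\<Sum>k\<in>{1..n}. indicator (F n k) x) = (\<Sum>k\<in>{1..n}. if real k \<le> real n * f x then 1 else (0::real))"
      using that by (intro sum.cong) (auto simp: F_def indicator_def)
    also have "\<dots> = real (card {k\<in>{1..n}. real k \<le> real n * f x})"
      by (subst sum.inter_filter[symmetric]) auto
    also have "{k\<in>{1..n}. real k \<le> real n * f x} = {1..nat \<lfloor>real n * f x\<rfloor>}"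
    proof -
      have "real n * f x \<le> real n" using f1[of x] by (simp add: mult_left_le)
      then have "real k \<le> real n * f x \<longleftrightarrow> k \<le> nat \<lfloor>real n * f x\<rfloor>" "k \<le> nat \<lfloor>real n * f x\<rfloor> \<Longrightarrow> k \<le> n" for k
        using f0[of x] by (auto simp: le_nat_iff le_floor_iff nat_le_iff floor_le_iff)
      then show ?thesis by auto
    qed
    finally show ?thesis unfolding g_def using f0[of x] by simp
  qed
  have approx: "g n x \<le> f x" "f x \<le> g n x + 1 / real n" if "x \<in> space M" "0 < n" for x n
    using that(2) unfolding g[OF that(1)] by (auto simp: field_simps) linarith+
  have int: "g n \<in> borel_measurable M" for n unfolding g_def using FM by measurable
  have Lg: "integrable L (g n) \<and> (\<integral>x. g n x \<partial>L) = (\<Sum>k\<in>{1..n}. measure L (F n k)) / real n \<and>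
      (0 < n \<longrightarrow> (\<integral>x. g n x \<partial>L) \<le> (\<integral>x. f x \<partial>L) \<and> (\<integral>x. f x \<partial>L) \<le> (\<integral>x. g n x \<partial>L) + 1 / real n)"
    if L: "prob_space L" "sets L = sets M" for L n
  proof -
    interpret L: prob_space L by fact
    have F: "F n k \<in> sets L" for k using FM L by simp
    have i1: "integrable L (\<lambda>x. indicator (F n k) x :: real)" for k
      using F by (simp add: L.emeasure_eq_measure less_top)
    have fL: "f \<in> borel_measurable L" using f by (simp add: measurable_cong_sets[OF L(2) refl])
    have i2: "integrable L f" using f0 f1 by (intro L.integrable_const_bound[where B=1] fL) auto
    have i3: "integrable L (g n)" unfolding g_def using i1 by auto
    have "(\<integral>x. g n x \<partial>L) \<le> (\<integral>x. f x \<partial>L)" "(\<integral>x. f x \<partial>L) \<le> (\<integral>x. g n x + 1 / real n \<partial>L)" if "0 < n"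
      using approx that sets_eq_imp_space_eq[OF L(2)] by (auto intro!: integral_mono i2 i3)
    moreover have "(\<integral>x. g n x + 1 / real n \<partial>L) = (\<integral>x. g n x \<partial>L) + 1 / real n"
      using i3 by (simp add: L.prob_space)
    moreover have "(\<integral>x. g n x \<partial>L) = (\<Sum>k\<in>{1..n}. measure L (F n k)) / real n"
      unfolding g_def using i1 F by (simp add: Bochner_Integration.integral_sum)
    ultimately show ?thesis using i3 by auto
  qed
  have "\<bar>(\<integral>x. f x \<partial>M) - (\<integral>x. f x \<partial>N)\<bar> \<le> d + e" if "0 < e" for e
  proof -
    obtain n where n: "1 / real (Suc n) < e" using \<open>0 < e\<close> nat_approx_posE by blast
    define m where "m = Suc n"
    have "\<bar>(\<Sum>k\<in>{1..m}. measure M (F m k)) - (\<Sum>k\<in>{1..m}. measure N (F m k))\<bar>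
        \<le> (\<Sum>k\<in>{1..m}. \<bar>measure M (F m k) - measure N (F m k)\<bar>)"
      by (subst sum_subtractf[symmetric]) (rule sum_abs)
    also have "\<dots> \<le> real m * d" using sum_bounded_above[of "{1..m}" "\<lambda>k. \<bar>measure M (F m k) - measure N (F m k)\<bar>" d] le FM by auto
    finally have "\<bar>(\<Sum>k\<in>{1..m}. measure M (F m k)) - (\<Sum>k\<in>{1..m}. measure N (F m k))\<bar> \<le> real m * d" .
    moreover have "(\<integral>x. g m x \<partial>M) - (\<integral>x. g m x \<partial>N)
        = ((\<Sum>k\<in>{1..m}. measure M (F m k)) - (\<Sum>k\<in>{1..m}. measure N (F m k))) / real m"
      using Lg[OF M refl, of m] Lg[OF N sets, of m] by (simp only: diff_divide_distrib)
    moreover have "0 < real m" by (simp add: m_def)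
    ultimately have "\<bar>(\<integral>x. g m x \<partial>M) - (\<integral>x. g m x \<partial>N)\<bar> \<le> d"
      by (simp add: abs_divide pos_divide_le_eq mult.commute del: of_nat_Suc)
    moreover have "1 / real m < e" "0 < m" using n by (auto simp: m_def)
    ultimately show ?thesis using Lg[OF M refl, of m] Lg[OF N sets, of m] by linarith
  qed
  then show ?thesis by (rule field_le_epsilon)
qed

lemma integral_diff_le:
  fixes g :: "'b \<Rightarrow> real"
  assumes M: "prob_space M" and N: "prob_space N" and sets: "sets N = sets M"
    and le: "\<And>A. A \<in> sets M \<Longrightarrow> \<bar>measure M A - measure N A\<bar> \<le> d"
    and g: "g \<in> borel_measurable M" and gB: "\<And>x. \<bar>g x\<bar> \<le> B"
  shows "\<bar>(\<integral>x. g x \<partial>M) - (\<integral>x. g x \<partial>N)\<bar> \<le> 2 * B * d"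
proof (cases "0 < B")
  case False
  then have "g x = 0" for x using gB[of x] by linarith
  moreover have "B = 0" using False gB[of undefined] by linarith
  ultimately show ?thesis by simp
next
  case B: True
  define f where "f x = (g x + B) / (2 * B)" for x
  have *: "0 \<le> f x" "f x \<le> 1" for x using gB[of x] B by (auto simp: f_def field_simps)
  have "\<bar>(\<integral>x. f x \<partial>M) - (\<integral>x. f x \<partial>N)\<bar> \<le> d"
    using g by (intro integral_diff_le_unit[OF M N sets le _ *]) (auto simp: f_def)
  moreover have "(\<integral>x. f x \<partial>L) = ((\<integral>x. g x \<partial>L) + B) / (2 * B)" if L: "prob_space L" "sets L = sets M" for L
  proof -
    interpret L: prob_space L by fact
    have "integrable L g" using gB g
      by (intro L.integrable_const_bound[where B=B]) (auto simp: measurable_cong_sets[OF L(2) refl])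
    then show ?thesis unfolding f_def by (simp add: L.prob_space)
  qed
  ultimately have "\<bar>((\<integral>x. g x \<partial>M) - (\<integral>x. g x \<partial>N)) / (2 * B)\<bar> \<le> d"
    using M N sets by (simp add: diff_divide_distrib add_divide_distrib)
  then show ?thesis using B by (simp add: abs_divide field_simps)
qed

lemma sum_measure_diff:
  assumes "finite_measure M" "finite_measure N" "sets N = sets M"
    and "finite \<A>" "disjoint \<A>" "\<A> \<subseteq> sets M"
  shows "(\<Sum>A\<in>\<A>. measure M A - measure N A) = measure M (\<Union>\<A>) - measure N (\<Union>\<A>)"
proof -
  have "measure L (\<Union>\<A>) = (\<Sum>A\<in>\<A>. measure L A)" if "finite_measure L" "sets L = sets M" for L
    using finite_measure.finite_measure_finite_Union[OF that(1) assms(4), of "\<lambda>A. A"] assms that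
    by (auto simp: disjoint_family_on_def disjoint_def)
  then show ?thesis using assms by (simp add: sum_subtractf)
qed

text \<open>
  Only the pieces where the signed measure is nonnegative and those where it is negative need to be
  told apart: each group contributes the modulus of the signed measure of one union.
\<close>

lemma sum_abs_measure_diff_le:
  assumes M: "finite_measure M" "finite_measure N" "sets N = sets M"
    and d: "\<And>A. A \<in> sets M \<Longrightarrow> \<bar>measure M A - measure N A\<bar> \<le> d"
    and A: "finite \<A>" "disjoint \<A>" "\<A> \<subseteq> sets M"
  shows "(\<Sum>A\<in>\<A>. \<bar>measure M A - measure N A\<bar>) \<le> 2 * d"
proof -
  let ?\<sigma> = "\<lambda>A. measure M A - measure N A"
  define \<P> where "\<P> = {A\<in>\<A>. 0 \<le> ?\<sigma> A}"
  have sub: "\<P> \<subseteq> \<A>" "\<A> - \<P> \<subseteq> \<A>" unfolding \<P>_def by auto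
  have part: "\<bar>sum ?\<sigma> \<B>\<bar> \<le> d" if "\<B> \<subseteq> \<A>" for \<B>
  proof -
    have *: "finite \<B>" "disjoint \<B>" "\<B> \<subseteq> sets M"
      using that A finite_subset pairwise_subset[OF A(2)] by auto
    then have "\<Union>\<B> \<in> sets M" by (intro sets.finite_Union) auto
    then show ?thesis using d sum_measure_diff[OF M *] by simp
  qed
  have "(\<Sum>A\<in>\<A>. \<bar>?\<sigma> A\<bar>) = (\<Sum>A\<in>\<A> - \<P>. \<bar>?\<sigma> A\<bar>) + (\<Sum>A\<in>\<P>. \<bar>?\<sigma> A\<bar>)"
    by (rule sum.subset_diff[OF sub(1) A(1)])
  also have "\<dots> = (\<Sum>A\<in>\<A> - \<P>. - ?\<sigma> A) + (\<Sum>A\<in>\<P>. ?\<sigma> A)"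
    by (intro arg_cong2[where f="(+)"] sum.cong) (auto simp: \<P>_def)
  also have "\<dots> = sum ?\<sigma> \<P> - sum ?\<sigma> (\<A> - \<P>)" by (simp only: sum_negf)
  finally show ?thesis using part[OF sub(1)] part[OF sub(2)] by linarith
qed

text \<open>
  The total variation norm is thus equivalent to the supremum over single Borel sets, and all
  estimates below are proved set by set.
\<close>

lemma tv_norm_measure_diff:
  fixes M N :: "'a::topological_space measure"
  assumes M: "prob_space M" "prob_space N" "sets M = sets borel" "sets N = sets borel"
    and \<sigma>: "\<And>A. A \<in> sets borel \<Longrightarrow> \<sigma> A = measure M A - measure N A"
  shows tv_norm_le: "(\<And>A. A \<in> sets borel \<Longrightarrow> \<bar>\<sigma> A\<bar> \<le> d) \<Longrightarrow> tv_norm \<sigma> \<le> 2 * d"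
    and abs_le_tv_norm: "A \<in> sets borel \<Longrightarrow> \<bar>\<sigma> A\<bar> \<le> tv_norm \<sigma>"
proof -
  let ?T = "{\<Sum>A\<in>\<A>. \<bar>\<sigma> A\<bar> | \<A>. finite \<A> \<and> disjoint \<A> \<and> \<A> \<subseteq> sets borel}"
  have fin: "finite_measure M" "finite_measure N" using M by (auto simp: prob_space.finite_measure)
  have le: "t \<le> 2 * d" if t: "t \<in> ?T" and d: "\<And>A. A \<in> sets borel \<Longrightarrow> \<bar>\<sigma> A\<bar> \<le> d" for t d
  proof -
    obtain \<A> where A: "finite \<A>" "disjoint \<A>" "\<A> \<subseteq> sets borel" "t = (\<Sum>A\<in>\<A>. \<bar>\<sigma> A\<bar>)"
      using t by blast
    have "t = (\<Sum>A\<in>\<A>. \<bar>measure M A - measure N A\<bar>)" unfolding A(4) using A \<sigma> by (intro sum.cong) auto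
    also have "\<dots> \<le> 2 * d"
    proof (rule sum_abs_measure_diff_le[OF fin _ _ A(1,2)])
      show "\<bar>measure M B - measure N B\<bar> \<le> d" if "B \<in> sets M" for B
        using d[of B] \<sigma>[of B] that M by simp
    qed (use A M in simp_all)
    finally show ?thesis .
  qed
  have "(\<Sum>A\<in>{}. \<bar>\<sigma> A\<bar>) \<in> ?T"
    by (intro CollectI exI[of _ "{}"]) (auto simp: disjoint_def)
  then have ne: "?T \<noteq> {}" by (metis empty_iff)
  show "tv_norm \<sigma> \<le> 2 * d" if "\<And>A. A \<in> sets borel \<Longrightarrow> \<bar>\<sigma> A\<bar> \<le> d"
    unfolding tv_norm_def using ne le[OF _ that] by (rule cSup_least)
  assume A: "A \<in> sets borel"
  have "\<bar>\<sigma> B\<bar> \<le> 1" if "B \<in> sets borel" for B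
    using \<sigma>[OF that] M by (simp add: abs_le_iff) (smt (verit) measure_nonneg prob_space.prob_le_1)
  then have bdd: "bdd_above ?T" by (intro bdd_aboveI[of _ "2 * 1"] le)
  have "\<bar>\<sigma> A\<bar> = (\<Sum>B\<in>{A}. \<bar>\<sigma> B\<bar>)" by simp
  then have "\<bar>\<sigma> A\<bar> \<in> ?T" using A by (intro CollectI exI[of _ "{A}"]) (auto simp: disjoint_def)
  then show "\<bar>\<sigma> A\<bar> \<le> tv_norm \<sigma>" unfolding tv_norm_def using bdd by (rule cSup_upper)
qed

text \<open>
  The limit set function is finitely additive as a pointwise limit. Because the convergence is uniform
  in the set, continuity at \<open>\<emptyset>\<close> passes to the limit as well, and this gives countable additivity.
\<close>

lemma ex_limit_of_uniformly_Cauchy_measures: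
  fixes N :: "nat \<Rightarrow> 'b measure"
  assumes N: "\<And>n. prob_space (N n)" "\<And>n. sets (N n) = sets L"
    and Cauchy: "\<And>n m A. n \<le> m \<Longrightarrow> A \<in> sets L \<Longrightarrow> \<bar>measure (N n) A - measure (N m) A\<bar> \<le> \<epsilon> n"
    and \<epsilon>: "\<epsilon> \<longlonglongrightarrow> 0"
  shows "\<exists>\<alpha>. prob_space \<alpha> \<and> sets \<alpha> = sets L \<and> (\<forall>A\<in>sets L. (\<lambda>n. measure (N n) A) \<longlonglongrightarrow> measure \<alpha> A)"
proof -
  define a where "a A = lim (\<lambda>n. measure (N n) A)" for A
  have lim: "(\<lambda>n. measure (N n) A) \<longlonglongrightarrow> a A" if A: "A \<in> sets L" for A
  proof -
    have "Cauchy (\<lambda>n. measure (N n) A)"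
    proof (rule metric_CauchyI)
      fix e :: real assume "0 < e"
      then have "\<forall>\<^sub>F n in sequentially. \<epsilon> n < e / 2" using order_tendstoD(2)[OF \<epsilon>, of "e / 2"] by simp
      then obtain n where n: "\<epsilon> n < e / 2" by (auto simp: eventually_sequentially)
      have "dist (measure (N m) A) (measure (N k) A) < e" if "n \<le> m" "n \<le> k" for m k
        using Cauchy[OF that(1) A] Cauchy[OF that(2) A] n unfolding dist_real_def by linarith
      then show "\<exists>M. \<forall>m\<ge>M. \<forall>k\<ge>M. dist (measure (N m) A) (measure (N k) A) < e" by blast
    qed
    then show ?thesis unfolding a_def
      by (simp add: Cauchy_convergent convergent_LIMSEQ_iff[symmetric])
  qed
  have close: "\<bar>measure (N n) A - a A\<bar> \<le> \<epsilon> n" if A: "A \<in> sets L" for n A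
  proof -
    have "(\<lambda>m. \<bar>measure (N n) A - measure (N m) A\<bar>) \<longlonglongrightarrow> \<bar>measure (N n) A - a A\<bar>"
      by (intro tendsto_intros lim A)
    then show ?thesis
      by (rule LIMSEQ_le_const2) (auto intro!: exI[of _ n] Cauchy A)
  qed
  have a0: "0 \<le> a A" if "A \<in> sets L" for A using lim[OF that] by (rule LIMSEQ_le_const) auto
  define \<alpha> where "\<alpha> = measure_of (space L) (sets L) (\<lambda>A. ennreal (a A))"
  have "countably_additive (sets L) (\<lambda>A. ennreal (a A))"
  proof (rule sets.empty_continuous_imp_countably_additive)
    have "(\<lambda>n. measure (N n) {}) \<longlonglongrightarrow> a {}" by (rule lim) simp
    then have "a {} = 0" by (simp add: LIMSEQ_const_iff)
    then show "positive (sets L) (\<lambda>A. ennreal (a A))" by (simp add: positive_def)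
    show "additive (sets L) (\<lambda>A. ennreal (a A))"
      unfolding additive_def
    proof (intro ballI impI)
      fix A B assume AB: "A \<in> sets L" "B \<in> sets L" "A \<inter> B = {}"
      have "measure (N n) (A \<union> B) = measure (N n) A + measure (N n) B" for n
        using finite_measure.finite_measure_Union[OF prob_space.finite_measure[OF N(1)[of n]]] AB N by simp
      then have "(\<lambda>n. measure (N n) A + measure (N n) B) \<longlonglongrightarrow> a (A \<union> B)" using lim[of "A \<union> B"] AB by simp
      moreover have "(\<lambda>n. measure (N n) A + measure (N n) B) \<longlonglongrightarrow> a A + a B"
        by (intro tendsto_add lim AB)
      ultimately have "a (A \<union> B) = a A + a B" by (rule LIMSEQ_unique)
      then show "ennreal (a (A \<union> B)) = ennreal (a A) + ennreal (a B)"
        using a0[OF AB(1)] a0[OF AB(2)] by simp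
    qed
    show "\<forall>A\<in>sets L. ennreal (a A) \<noteq> \<infinity>" by simp
    fix A :: "nat \<Rightarrow> 'b set" assume A: "range A \<subseteq> sets L" "decseq A" "(\<Inter>i. A i) = {}"
    have "(\<lambda>i. a (A i)) \<longlonglongrightarrow> 0"
    proof (rule LIMSEQ_I)
      fix e :: real assume e: "0 < e"
      then have "\<forall>\<^sub>F n in sequentially. \<epsilon> n < e / 2" using order_tendstoD(2)[OF \<epsilon>, of "e / 2"] by simp
      then obtain n where n: "\<epsilon> n < e / 2" by (auto simp: eventually_sequentially)
      interpret Nn: prob_space "N n" by (rule N)
      have "(\<lambda>i. measure (N n) (A i)) \<longlonglongrightarrow> measure (N n) (\<Inter>i. A i)"
        using A N by (intro Nn.finite_Lim_measure_decseq) auto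
      then have "\<forall>\<^sub>F i in sequentially. measure (N n) (A i) < e / 2"
        using order_tendstoD(2)[of _ "0::real" _ "e / 2"] e A(3) by simp
      then obtain k where k: "\<And>i. k \<le> i \<Longrightarrow> measure (N n) (A i) < e / 2" by (auto simp: eventually_sequentially)
      have "norm (a (A i) - 0) < e" if "k \<le> i" for i
      proof -
        have Ai: "A i \<in> sets L" using A by auto
        show ?thesis using k[OF that] n close[OF Ai, of n] a0[OF Ai] by (simp add: abs_le_iff)
      qed
      then show "\<exists>no. \<forall>i\<ge>no. norm (a (A i) - 0) < e" by blast
    qed
    then show "(\<lambda>i. ennreal (a (A i))) \<longlonglongrightarrow> 0" using tendsto_ennrealI[of _ 0] by fastforce
  qed
  moreover have pos: "positive (sets L) (\<lambda>A. ennreal (a A))"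
  proof -
    have "(\<lambda>n. measure (N n) {}) \<longlonglongrightarrow> a {}" by (rule lim) simp
    then show ?thesis by (simp add: positive_def LIMSEQ_const_iff)
  qed
  ultimately have em: "emeasure \<alpha> A = ennreal (a A)" if "A \<in> sets L" for A
    using emeasure_measure_of_sigma[OF sets.sigma_algebra_axioms, of L] that
    unfolding \<alpha>_def by blast
  have s\<alpha>: "sets \<alpha> = sets L" "space \<alpha> = space L"
    unfolding \<alpha>_def using sets.space_closed[of L] by (auto simp: sets.sigma_sets_eq)
  have "(\<lambda>n. measure (N n) (space L)) \<longlonglongrightarrow> a (space L)" by (rule lim) simp
  moreover have "measure (N n) (space L) = 1" for n
    using prob_space.prob_space[OF N(1)[of n]] sets_eq_imp_space_eq[OF N(2)] by simp
  ultimately have "a (space L) = 1" by (simp add: LIMSEQ_const_iff)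
  then have "prob_space \<alpha>" using em[of "space L"] s\<alpha> by (intro prob_spaceI) simp
  moreover have "measure \<alpha> A = a A" if "A \<in> sets L" for A
    using em[OF that] a0[OF that] by (simp add: measure_def)
  ultimately show ?thesis using s\<alpha> lim by (intro exI[of _ \<alpha>]) auto
qed

section \<open>Small sets of kernels that are continuous in total variation\<close>

lemma ex_countable_dense_of_compact:
  assumes "compact (UNIV :: 'a::metric_space set)"
  shows "\<exists>D :: 'a set. countable D \<and> (\<forall>x. \<forall>r>0. \<exists>d\<in>D. dist x d < r)"
proof -
  have "\<forall>n. \<exists>k :: 'a set. finite k \<and> UNIV \<subseteq> (\<Union>x\<in>k. ball x (1 / real (Suc n)))"
    using assms unfolding compact_eq_totally_bounded by auto
  then obtain k :: "nat \<Rightarrow> 'a set" where fin: "\<And>n. finite (k n)"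
    and cov: "\<And>n. UNIV \<subseteq> (\<Union>x\<in>k n. ball x (1 / real (Suc n)))" by metis
  have "\<exists>d\<in>(\<Union>n. k n). dist x d < r" if "0 < r" for x and r :: real
  proof -
    obtain n where n: "1 / real (Suc n) < r" using \<open>0 < r\<close> nat_approx_posE by blast
    obtain d where "d \<in> k n" "dist d x < 1 / real (Suc n)" using cov[of n] by fastforce
    then show ?thesis using n by (intro bexI[of _ d]) (auto simp: dist_commute)
  qed
  then show ?thesis using fin by (intro exI[of _ "\<Union>n. k n"])
    (auto simp: countable_finite)
qed

text \<open>
  Averaging the measures \<open>K d\<close> over a dense sequence of points \<open>d\<close>, with positive weights, gives the
  dominating measure: a set that is null for the average is null for every \<open>K d\<close>, hence for every
  \<open>K y\<close> by continuity.
\<close>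

lemma ex_dominating_measure:
  fixes K :: "'a::metric_space \<Rightarrow> 'a measure"
  assumes cpt: "compact (UNIV :: 'a set)"
    and K: "K \<in> borel \<rightarrow>\<^sub>M prob_algebra borel"
    and cont: "\<And>x e. 0 < e \<Longrightarrow>
      \<exists>r>0. \<forall>y\<in>ball x r. \<forall>A\<in>sets borel. \<bar>measure (K y) A - measure (K x) A\<bar> \<le> e"
  shows "\<exists>m. prob_space m \<and> sets m = sets borel \<and> (\<forall>y. absolutely_continuous m (K y))"
proof -
  obtain D :: "'a set" where D: "countable D" and dense: "\<And>x r. 0 < r \<Longrightarrow> \<exists>d\<in>D. dist x d < r"
    using ex_countable_dense_of_compact[OF cpt] by blast
  have "D \<noteq> {}" using dense[of 1] by auto
  define d where "d = from_nat_into D"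
  define q where "q = geometric_pmf (1 / 2)"
  have q: "set_pmf q = UNIV" unfolding q_def by (subst set_pmf_geometric) auto
  define m where "m = distr (measure_pmf q) borel d \<bind> K"
  have dm: "d \<in> measure_pmf q \<rightarrow>\<^sub>M borel" by auto
  interpret dq: prob_space "distr (measure_pmf q) borel d"
    by (intro prob_space.prob_space_distr measure_pmf.prob_space_axioms dm)
  have in_alg: "distr (measure_pmf q) borel d \<in> space (prob_algebra borel)"
    using dq.prob_space_axioms by (simp add: space_prob_algebra)
  have m: "prob_space m" "sets m = sets borel"
    unfolding m_def using prob_space_bind'[OF in_alg K] sets_bind'[OF in_alg K] by auto
  have Kx: "prob_space (K x)" "sets (K x) = sets borel" for x
    using measurable_space[OF K, of x] by (auto simp: space_prob_algebra)
  have "absolutely_continuous m (K y)" for y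
    unfolding absolutely_continuous_def
  proof
    fix A assume A: "A \<in> null_sets m"
    then have Ab: "A \<in> sets borel" using m by auto
    have em: "emeasure m A = (\<integral>\<^sup>+n. emeasure (K (d n)) A \<partial>measure_pmf q)"
      unfolding m_def
      using in_alg K Ab
      by (subst emeasure_bind_prob_algebra[OF in_alg K Ab], subst nn_integral_distr[OF dm])
        (auto intro!: measurable_compose[OF measurable_prob_algebraD[OF K] measurable_emeasure_subprob_algebra])
    have "emeasure m A = 0" using A by auto
    then have "AE n in measure_pmf q. emeasure (K (d n)) A = 0"
      unfolding em by (subst (asm) nn_integral_0_iff_AE) auto
    then have zero: "emeasure (K (d n)) A = 0" for n
      using q by (simp add: AE_measure_pmf_iff)
    have "measure (K y) A \<le> e" if "0 < e" for e :: real
    proof -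
      obtain r where r: "0 < r" "\<And>z. z \<in> ball y r \<Longrightarrow> \<bar>measure (K z) A - measure (K y) A\<bar> \<le> e"
        using cont[OF \<open>0 < e\<close>, of y] Ab by blast
      obtain z where z: "z \<in> D" "dist y z < r" using dense r by blast
      obtain n where "z = d n"
        using z D \<open>D \<noteq> {}\<close> unfolding d_def by (metis from_nat_into_surj)
      then have "measure (K z) A = 0" using zero by (simp add: measure_def)
      with r(2)[of z] z show ?thesis by auto
    qed
    then have "measure (K y) A \<le> 0" by (rule field_le_epsilon[of _ 0, simplified])
    then have "emeasure (K y) A = 0"
      using prob_space.finite_measure[OF Kx(1)] by (simp add: finite_measure.emeasure_eq_measure measure_le_0_iff)
    then show "A \<in> null_sets (K y)" using Ab Kx by auto
  qed
  then show ?thesis using m by blast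
qed

text \<open>
  The density of \<open>K y\<close> is wanted jointly measurable in \<open>y\<close> and in the space variable. Instead of
  selecting a good version of the density for each \<open>y\<close>, take one Radon-Nikodym derivative on the
  product space, that of the measure \<open>m(dy) K(y, dz)\<close>. The resulting identity is integrated over \<open>y\<close>,
  and no version has to be chosen for individual \<open>y\<close>.
\<close>

lemma ex_joint_density:
  fixes K :: "'a \<Rightarrow> 'b measure"
  assumes m: "prob_space m" and l: "prob_space l" and K: "K \<in> m \<rightarrow>\<^sub>M prob_algebra l"
    and ac: "\<And>y. y \<in> space m \<Longrightarrow> absolutely_continuous l (K y)"
  shows "\<exists>f\<in>borel_measurable (m \<Otimes>\<^sub>M l). \<forall>B\<in>sets m. \<forall>A\<in>sets l.
    (\<integral>\<^sup>+y. emeasure (K y) A * indicator B y \<partial>m)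
      = (\<integral>\<^sup>+z. (\<integral>\<^sup>+y. f (y, z) * indicator B y \<partial>m) * indicator A z \<partial>l)"
proof -
  interpret m: prob_space m by fact
  interpret l: prob_space l by fact
  interpret ml: pair_prob_space m l ..
  note Ks = measurable_prob_algebraD[OF K]
  have [measurable]: "(\<lambda>y. distr (K y) (m \<Otimes>\<^sub>M l) (Pair y)) \<in> m \<rightarrow>\<^sub>M subprob_algebra (m \<Otimes>\<^sub>M l)"
    by (rule measurable_distr2[OF _ Ks]) simp
  have Ky: "sets (K y) = sets l" "space (K y) = space l" "prob_space (K y)" if "y \<in> space m" for y
    using measurable_space[OF K that] sets_eq_imp_space_eq[of "K y" l] by (auto simp: space_prob_algebra)
  define W where "W = m \<bind> (\<lambda>y. distr (K y) (m \<Otimes>\<^sub>M l) (Pair y))"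
  have sW: "sets W = sets (m \<Otimes>\<^sub>M l)"
    unfolding W_def by (rule sets_bind) (auto simp: m.not_empty)
  have eW: "emeasure W S = (\<integral>\<^sup>+y. emeasure (K y) (Pair y -` S) \<partial>m)" if S: "S \<in> sets (m \<Otimes>\<^sub>M l)" for S
  proof -
    have "emeasure W S = (\<integral>\<^sup>+y. emeasure (distr (K y) (m \<Otimes>\<^sub>M l) (Pair y)) S \<partial>m)"
      unfolding W_def by (rule emeasure_bind[OF m.not_empty _ S]) measurable
    also have "\<dots> = (\<integral>\<^sup>+y. emeasure (K y) (Pair y -` S) \<partial>m)"
    proof (rule nn_integral_cong)
      fix y assume y: "y \<in> space m"
      have "Pair y \<in> K y \<rightarrow>\<^sub>M m \<Otimes>\<^sub>M l"
        using y by (simp add: measurable_cong_sets[OF Ky(1)[OF y] refl])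
      moreover have "Pair y -` S \<inter> space (K y) = Pair y -` S"
        using sets.sets_into_space[OF S] Ky(2)[OF y] by (auto simp: space_pair_measure)
      ultimately show "emeasure (distr (K y) (m \<Otimes>\<^sub>M l) (Pair y)) S = emeasure (K y) (Pair y -` S)"
        by (subst emeasure_distr[OF _ S]) auto
    qed
    finally show ?thesis .
  qed
  have "absolutely_continuous (m \<Otimes>\<^sub>M l) W"
    unfolding absolutely_continuous_def
  proof
    fix S assume S: "S \<in> null_sets (m \<Otimes>\<^sub>M l)"
    then have Ss: "S \<in> sets (m \<Otimes>\<^sub>M l)" by auto
    have "(\<integral>\<^sup>+y. emeasure l (Pair y -` S) \<partial>m) = 0"
      using S by (subst l.emeasure_pair_measure_alt[OF Ss, symmetric]) auto
    then have "AE y in m. emeasure l (Pair y -` S) = 0"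
      using l.measurable_emeasure_Pair[OF Ss] by (subst (asm) nn_integral_0_iff_AE) auto
    then have "AE y in m. emeasure (K y) (Pair y -` S) = 0"
    proof (rule AE_mp, intro AE_I2 impI)
      fix y assume y: "y \<in> space m" "emeasure l (Pair y -` S) = 0"
      then have "Pair y -` S \<in> null_sets l" using sets_Pair1[OF Ss] by auto
      then show "emeasure (K y) (Pair y -` S) = 0"
        using ac[OF y(1)] unfolding absolutely_continuous_def by auto
    qed
    then have "emeasure W S = 0" unfolding eW[OF Ss]
      by (subst nn_integral_cong_AE[where v="\<lambda>_. 0"]) auto
    then show "S \<in> null_sets W" using Ss sW by auto
  qed
  then obtain f where f[measurable]: "f \<in> borel_measurable (m \<Otimes>\<^sub>M l)" and W: "density (m \<Otimes>\<^sub>M l) f = W"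
    using ml.P.Radon_Nikodym[OF _ sW] by blast
  have "(\<integral>\<^sup>+y. emeasure (K y) A * indicator B y \<partial>m)
      = (\<integral>\<^sup>+z. (\<integral>\<^sup>+y. f (y, z) * indicator B y \<partial>m) * indicator A z \<partial>l)"
    if [measurable]: "B \<in> sets m" "A \<in> sets l" for A B
  proof -
    have S: "B \<times> A \<in> sets (m \<Otimes>\<^sub>M l)" by measurable
    have "(\<integral>\<^sup>+y. emeasure (K y) A * indicator B y \<partial>m) = emeasure W (B \<times> A)"
      unfolding eW[OF S] by (intro nn_integral_cong) (auto split: split_indicator)
    also have "\<dots> = (\<integral>\<^sup>+p. f p * indicator (B \<times> A) p \<partial>(m \<Otimes>\<^sub>M l))"
      unfolding W[symmetric] by (rule emeasure_density) (auto simp: S)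
    also have "\<dots> = (\<integral>\<^sup>+z. \<integral>\<^sup>+y. f (y, z) * indicator (B \<times> A) (y, z) \<partial>m \<partial>l)"
      by (subst ml.nn_integral_snd[symmetric]) auto
    also have "\<dots> = (\<integral>\<^sup>+z. (\<integral>\<^sup>+y. f (y, z) * indicator B y \<partial>m) * indicator A z \<partial>l)"
      by (intro nn_integral_cong) (auto split: split_indicator intro!: nn_integral_cong)
    finally show ?thesis .
  qed
  then show ?thesis by (intro bexI[of _ f]) auto
qed


lemma ex_divide_Suc_le_ennreal:
  fixes x :: ennreal
  assumes "x \<noteq> 0" "0 < c"
  shows "\<exists>n. ennreal (c / real (Suc n)) \<le> x"
proof -
  obtain e where e: "0 < e" "ennreal e \<le> x"
  proof (cases x)
    case (real r)
    with assms(1) show ?thesis by (intro that[of r]) (auto simp: ennreal_eq_0_iff)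
  qed (auto intro: that[of 1])
  obtain n where "1 / real (Suc n) < e / c"
    using nat_approx_posE[of "e / c"] e assms by auto
  then have "c / real (Suc n) \<le> e" using assms by (simp add: field_simps)
  then show ?thesis using e by (meson ennreal_leI order_trans)
qed

text \<open>
  A kernel that depends continuously on its starting point in total variation has small sets: near
  every point the two-step kernels dominate one and the same nonzero measure.

  Let \<open>m\<close> dominate all \<open>K y\<close>, with joint density \<open>f\<close>, and let \<open>g x\<close> be the density of \<open>K x\<close>. Let \<open>G\<close>
  be a set where \<open>g x\<^sub>0\<close> is at least \<open>a > 0\<close>. For \<open>x\<close> close to \<open>x\<^sub>0\<close>, the part \<open>N\<close> of \<open>G\<close> where \<open>g x\<close> is
  below \<open>a / 2\<close> has small \<open>m\<close>-measure, since \<open>K x\<^sub>0 N - K x N\<close> is at least \<open>a / 2 \<cdot> m N\<close>. The set \<open>N\<close>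
  depends on \<open>x\<close>, and removing it costs, in the density of the second step at \<open>z\<close>, the integral of
  \<open>f(y, z)\<close> over \<open>y \<in> N\<close>. Truncating \<open>f\<close> at \<open>1\<close> makes this loss at most \<open>m N\<close>, uniformly in \<open>z\<close>. On
  the set \<open>H\<close> of those \<open>z\<close> for which the truncated integral \<open>h z\<close> over all of \<open>G\<close> is at least \<open>2 \<eta>\<close>, a
  contribution \<open>\<eta>\<close> therefore survives for every \<open>x\<close> near \<open>x\<^sub>0\<close>.
\<close>

lemma local_minorization:
  fixes K :: "'a::metric_space \<Rightarrow> 'a measure"
  assumes cpt: "compact (UNIV :: 'a set)"
    and K: "K \<in> borel \<rightarrow>\<^sub>M prob_algebra borel"
    and cont: "\<And>x e. 0 < e \<Longrightarrow>
      \<exists>r>0. \<forall>y\<in>ball x r. \<forall>A\<in>sets borel. \<bar>measure (K y) A - measure (K x) A\<bar> \<le> e"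
    and F: "F \<in> sets borel" and pos: "0 < measure (K x0 \<bind> K) F"
  shows "\<exists>r>0. \<exists>c>0. \<exists>\<nu>. prob_space \<nu> \<and> sets \<nu> = sets borel \<and> measure \<nu> F = 1 \<and>
    (\<forall>x\<in>ball x0 r. \<forall>A\<in>sets borel. c * measure \<nu> A \<le> measure (K x \<bind> K) A)"
proof -
  obtain m where m: "prob_space m" "sets m = sets borel" and ac: "\<And>y. absolutely_continuous m (K y)"
    using ex_dominating_measure[OF cpt K cont] by blast
  interpret m: prob_space m by fact
  interpret mm: pair_prob_space m m ..
  note [measurable_cong] = m(2)
  have Kx: "prob_space (K x)" "sets (K x) = sets borel" "K x \<in> space (prob_algebra borel)" for x
    using measurable_space[OF K, of x] by (auto simp: space_prob_algebra)
  have spm: "space m = UNIV" using sets_eq_imp_space_eq[OF m(2)] by simp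
  have Km: "K \<in> m \<rightarrow>\<^sub>M prob_algebra m"
    using K by (simp add: measurable_cong_sets[OF m(2)] prob_algebra_def subprob_algebra_cong[OF m(2)])
  have Kem[measurable]: "(\<lambda>y. emeasure (K y) A) \<in> borel_measurable borel" if "A \<in> sets borel" for A
    using measurable_compose[OF measurable_prob_algebraD[OF K] measurable_emeasure_subprob_algebra[OF that]] .
  obtain f where f[measurable]: "f \<in> borel_measurable (m \<Otimes>\<^sub>M m)"
    and fK: "\<And>A B. A \<in> sets borel \<Longrightarrow> B \<in> sets borel \<Longrightarrow>
      (\<integral>\<^sup>+y. emeasure (K y) A * indicator B y \<partial>m)
        = (\<integral>\<^sup>+z. (\<integral>\<^sup>+y. f (y, z) * indicator B y \<partial>m) * indicator A z \<partial>m)"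
    using ex_joint_density[OF m(1) m(1) Km ac] unfolding m(2) by blast
  have fz[measurable]: "(\<lambda>y. f (y, z)) \<in> borel_measurable m" for z
    by (rule measurable_compose[OF _ f]) (auto simp: spm)
  have "\<exists>g\<in>borel_measurable m. density m g = K x" for x
    using m.Radon_Nikodym[OF ac, of x] Kx m(2) by auto
  then obtain g where g[measurable]: "\<And>x. g x \<in> borel_measurable m" and gK: "\<And>x. density m (g x) = K x"
    by metis
  have eK: "emeasure (K x) A = (\<integral>\<^sup>+y. g x y * indicator A y \<partial>m)" if [measurable]: "A \<in> sets borel" for x A
    unfolding gK[symmetric] by (rule emeasure_density) auto
  have K2: "emeasure (K x \<bind> K) A = (\<integral>\<^sup>+y. g x y * emeasure (K y) A \<partial>m)"
    if [measurable]: "A \<in> sets borel" for x A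
    unfolding emeasure_bind_prob_algebra[OF Kx(3) K that]
    by (subst gK[symmetric], rule nn_integral_density) auto
  define G where "G n = {y. ennreal (1 / real (Suc n)) \<le> g x0 y}" for n
  have G[measurable]: "G n \<in> sets borel" for n
  proof -
    have "{y\<in>space m. ennreal (1 / real (Suc n)) \<le> g x0 y} \<in> sets m" by measurable
    then show ?thesis unfolding G_def m(2) spm by simp
  qed
  define h where "h n z = (\<integral>\<^sup>+y. min (f (y, z)) 1 * indicator (G n) y \<partial>m)" for n z
  have h[measurable]: "h n \<in> borel_measurable m" for n unfolding h_def by measurable
  \<comment> \<open>If \<open>h n\<close> vanished on \<open>F\<close> for every level \<open>1 / (n + 1)\<close> of \<open>g x0\<close>, the two-step kernel from \<open>x0\<close>
    would not charge \<open>F\<close>.\<close>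
  have "\<exists>n. \<not> (AE z in m. h n z * indicator F z = 0)"
  proof (rule ccontr)
    assume "\<not> ?thesis"
    then have AEh: "AE z in m. h n z * indicator F z = 0" for n by auto
    have zero: "(\<integral>\<^sup>+y. emeasure (K y) F * indicator (G n) y \<partial>m) = 0" for n
    proof -
      have "AE z in m. (\<integral>\<^sup>+y. f (y, z) * indicator (G n) y \<partial>m) * indicator F z = 0"
        using AEh[of n]
      proof eventually_elim
        case (elim z)
        show ?case
        proof (cases "z \<in> F")
          case True
          then have "h n z = 0" using elim by simp
          then have "AE y in m. min (f (y, z)) 1 * indicator (G n) y = 0"
            unfolding h_def by (subst (asm) nn_integral_0_iff_AE) auto
          then have "AE y in m. f (y, z) * indicator (G n) y = 0"
            by eventually_elim (auto split: split_indicator_asm split_indicator simp: min_def split: if_splits)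
          then have "(\<integral>\<^sup>+y. f (y, z) * indicator (G n) y \<partial>m) = 0"
            by (subst nn_integral_0_iff_AE) auto
          then show ?thesis by simp
        qed simp
      qed
      then show ?thesis unfolding fK[OF F G] using F by (subst nn_integral_0_iff_AE) auto
    qed
    have "AE y in m. \<forall>n. emeasure (K y) F * indicator (G n) y = 0"
      unfolding AE_all_countable using zero F by (subst (asm) nn_integral_0_iff_AE) auto
    then have "AE y in m. g x0 y * emeasure (K y) F = 0"
    proof eventually_elim
      case (elim y)
      show ?case
      proof (cases "g x0 y = 0")
        case False
        then obtain n where "y \<in> G n"
          using ex_divide_Suc_le_ennreal[of "g x0 y" 1] unfolding G_def by auto
        then show ?thesis using elim by (metis indicator_simps(1) mult.right_neutral mult_zero_right)
      qed simp
    qed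
    then have "emeasure (K x0 \<bind> K) F = 0" unfolding K2[OF F] using F by (subst nn_integral_0_iff_AE) auto
    then show False using pos by (simp add: measure_def)
  qed
  then obtain n where n: "\<not> (AE z in m. h n z * indicator F z = 0)" by blast
  define a where "a = 1 / real (Suc n)"
  have a: "0 < a" unfolding a_def by simp
  define H where "H k = {z\<in>F. ennreal (2 / real (Suc k)) \<le> h n z}" for k
  have H[measurable]: "H k \<in> sets borel" for k
  proof -
    have "{z\<in>space m. z \<in> F \<and> ennreal (2 / real (Suc k)) \<le> h n z} \<in> sets m" using F by measurable
    then show ?thesis unfolding H_def m(2) spm by simp
  qed
  have "\<exists>k. emeasure m (H k) \<noteq> 0"
  proof (rule ccontr)
    assume "\<not> ?thesis"
    then have "AE z in m. \<forall>k. z \<notin> H k" unfolding AE_all_countable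
      by (auto intro!: AE_not_in simp: null_sets_def m(2))
    then have "AE z in m. h n z * indicator F z = 0"
    proof eventually_elim
      case (elim z)
      show ?case
      proof (cases "z \<in> F \<and> h n z \<noteq> 0")
        case True
        then obtain k where "z \<in> H k"
          using ex_divide_Suc_le_ennreal[of "h n z" 2] unfolding H_def by auto
        with elim show ?thesis by blast
      qed auto
    qed
    with n show False by blast
  qed
  then obtain k where k: "emeasure m (H k) \<noteq> 0" by blast
  define \<eta> where "\<eta> = 1 / real (Suc k)"
  have \<eta>: "0 < \<eta>" unfolding \<eta>_def by simp
  obtain r where r: "0 < r" and close: "\<And>x A. x \<in> ball x0 r \<Longrightarrow> A \<in> sets borel \<Longrightarrow>
      \<bar>measure (K x) A - measure (K x0) A\<bar> \<le> a / 2 * \<eta>"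
    using cont[of "a / 2 * \<eta>" x0] a \<eta> by (metis half_gt_zero mult_pos_pos)
  define \<nu> where "\<nu> = uniform_measure m (H k)"
  have \<nu>: "prob_space \<nu>" "sets \<nu> = sets borel" unfolding \<nu>_def
    using k by (auto intro!: prob_space_uniform_measure simp: m(2))
  have m\<nu>: "measure \<nu> A = measure m (H k \<inter> A) / measure m (H k)" if "A \<in> sets borel" for A
    unfolding \<nu>_def using measure_uniform_measure[of m "H k" A] k that by (auto simp: m(2))
  have posH: "0 < measure m (H k)" using k by (simp add: m.emeasure_eq_measure zero_less_measure_iff)
  have "H k \<inter> F = H k" unfolding H_def by auto
  then have \<nu>F: "measure \<nu> F = 1" using m\<nu>[OF F] posH by simp
  have bound: "a / 2 * \<eta> * measure m (A \<inter> H k) \<le> measure (K x \<bind> K) A"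
    if x: "x \<in> ball x0 r" and A[measurable]: "A \<in> sets borel" for x A
  proof -
    define N where "N = {y\<in>G n. g x y < ennreal (a / 2)}"
    have N[measurable]: "N \<in> sets borel"
    proof -
      have "{y\<in>space m. y \<in> G n \<and> g x y < ennreal (a / 2)} \<in> sets m" by measurable
      then show ?thesis unfolding N_def m(2) spm by simp
    qed
    have "ennreal a * emeasure m N \<le> emeasure (K x0) N"
      unfolding eK[OF N] by (subst nn_integral_cmult_indicator[symmetric])
        (auto intro!: nn_integral_mono split: split_indicator simp: N_def G_def a_def m(2))
    moreover have "emeasure (K x) N \<le> ennreal (a / 2) * emeasure m N"
      unfolding eK[OF N] by (subst nn_integral_cmult_indicator[symmetric])
        (auto intro!: nn_integral_mono split: split_indicator simp: N_def a_def m(2))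
    ultimately have "a * measure m N \<le> measure (K x0) N" "measure (K x) N \<le> a / 2 * measure m N"
      using a Kx(1)[THEN prob_space.finite_measure]
      by (auto simp: m.emeasure_eq_measure finite_measure.emeasure_eq_measure ennreal_mult'[symmetric])
    moreover have "measure (K x0) N - measure (K x) N \<le> a / 2 * \<eta>" using close[OF x N] by linarith
    ultimately have "a * measure m N \<le> a * \<eta>" by (auto simp: field_simps)
    then have mN: "measure m N \<le> \<eta>" using a by simp
    \<comment> \<open>The factor \<open>2\<close> in the definition of \<open>H\<close> pays for the removal of \<open>N\<close>.\<close>
    have hN: "ennreal \<eta> * indicator (A \<inter> H k) z
        \<le> (\<integral>\<^sup>+y. f (y, z) * indicator (G n - N) y \<partial>m) * indicator A z" for z
    proof (cases "z \<in> A \<inter> H k")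
      case True
      have "ennreal (2 * \<eta>) \<le> h n z" using True by (simp add: H_def \<eta>_def)
      also have "h n z \<le> (\<integral>\<^sup>+y. f (y, z) * indicator (G n - N) y + indicator N y \<partial>m)"
        unfolding h_def by (intro nn_integral_mono) (auto split: split_indicator)
      also have "\<dots> = (\<integral>\<^sup>+y. f (y, z) * indicator (G n - N) y \<partial>m) + emeasure m N"
        by (subst nn_integral_add) (auto simp: m(2))
      also have "\<dots> \<le> (\<integral>\<^sup>+y. f (y, z) * indicator (G n - N) y \<partial>m) + ennreal \<eta>"
        using mN by (intro add_left_mono) (simp add: m.emeasure_eq_measure ennreal_leI)
      finally have "ennreal \<eta> + ennreal \<eta> \<le> (\<integral>\<^sup>+y. f (y, z) * indicator (G n - N) y \<partial>m) + ennreal \<eta>"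
        using \<eta> by (simp add: ennreal_plus[symmetric] del: ennreal_plus)
      then have "ennreal \<eta> \<le> (\<integral>\<^sup>+y. f (y, z) * indicator (G n - N) y \<partial>m)"
        using ennreal_add_left_cancel_le[of "ennreal \<eta>" "ennreal \<eta>"] by (simp add: add.commute)
      then show ?thesis using True by simp
    qed auto
    have "ennreal (a / 2 * \<eta> * measure m (A \<inter> H k)) = ennreal (a / 2) * (\<integral>\<^sup>+z. ennreal \<eta> * indicator (A \<inter> H k) z \<partial>m)"
      using a \<eta> by (subst nn_integral_cmult_indicator)
        (auto simp: m(2) m.emeasure_eq_measure ennreal_mult'[symmetric] mult.assoc)
    also have "\<dots> \<le> ennreal (a / 2) * (\<integral>\<^sup>+z. (\<integral>\<^sup>+y. f (y, z) * indicator (G n - N) y \<partial>m) * indicator A z \<partial>m)"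
      by (intro mult_left_mono nn_integral_mono hN) auto
    also have "\<dots> = ennreal (a / 2) * (\<integral>\<^sup>+y. emeasure (K y) A * indicator (G n - N) y \<partial>m)"
      by (subst fK) auto
    also have "\<dots> = (\<integral>\<^sup>+y. ennreal (a / 2) * (emeasure (K y) A * indicator (G n - N) y) \<partial>m)"
      by (rule nn_integral_cmult[symmetric]) auto
    also have "\<dots> \<le> (\<integral>\<^sup>+y. g x y * emeasure (K y) A \<partial>m)"
      by (intro nn_integral_mono) (auto split: split_indicator simp: N_def intro!: mult_right_mono)
    also have "\<dots> = emeasure (K x \<bind> K) A" by (rule K2[OF A, symmetric])
    finally show ?thesis
      using prob_space.finite_measure[OF prob_space_bind'[OF Kx(3)[of x] K]]
      by (simp add: finite_measure.emeasure_eq_measure)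
  qed
  have "a / 2 * \<eta> * measure m (H k) * measure \<nu> A \<le> measure (K x \<bind> K) A"
    if "x \<in> ball x0 r" "A \<in> sets borel" for x A
    using bound[OF that] posH m\<nu>[OF that(2)] by (simp add: Int_commute)
  moreover have "0 < a / 2 * \<eta> * measure m (H k)" using a \<eta> posH by simp
  ultimately show ?thesis using r \<nu> \<nu>F by blast
qed

section \<open>Semigroups of kernels with an absorbing point\<close>

lemma integral_pos_of_pos_on:
  fixes f :: "'a::topological_space \<Rightarrow> real"
  assumes \<mu>: "prob_measure_on E \<mu>" and E: "E \<in> sets borel" and int: "integrable \<mu> f"
    and f0: "\<And>x. 0 \<le> f x" and f1: "\<And>x. x \<in> E \<Longrightarrow> 0 < f x"
  shows "0 < (\<integral>x. f x \<partial>\<mu>)"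
proof (rule ccontr)
  assume neg: "\<not> ?thesis"
  have \<mu>': "prob_space \<mu>" "sets \<mu> = sets borel" "measure \<mu> E = 1"
    using \<mu> by (auto simp: prob_measure_on_def)
  interpret prob_space \<mu> by (rule \<mu>')
  have "0 \<le> (\<integral>x. f x \<partial>\<mu>)" using f0 by (simp add: integral_nonneg_AE)
  with neg have "(\<integral>x. f x \<partial>\<mu>) = 0" by linarith
  then have "AE x in \<mu>. f x = 0" using integral_nonneg_eq_0_iff_AE[OF int] f0 by simp
  moreover have "AE x in \<mu>. x \<in> E"
    using \<mu>' E by (intro AE_in_set_eq_1[THEN iffD2]) auto
  ultimately have "AE x in \<mu>. False"
    by eventually_elim (use f1 in force)
  then show False by simp
qed

text \<open>
  The kernels \<open>K t x\<close> stand for the law of \<open>X\<^sub>t\<close> under \<open>P x\<close> on the whole space, cemetery included.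
  Since the cemetery is absorbing, killing need not be built into the kernels: on functions that
  vanish at the cemetery, the conservative semigroup \<open>U\<close> below is the Dirichlet semigroup, and
  \<open>S t x\<close>, the mass of \<open>K t x\<close> on \<open>E\<close>, is the survival probability.
\<close>

locale absorbed_kernels =
  fixes E :: "'a::metric_space set" and cem :: 'a and K :: "real \<Rightarrow> 'a \<Rightarrow> 'a measure"
  assumes E_eq: "E = - {cem}"
    and K_kernel: "0 \<le> t \<Longrightarrow> K t \<in> borel \<rightarrow>\<^sub>M prob_algebra borel"
    and K_start: "K 0 x = return borel x"
    and K_add: "0 \<le> s \<Longrightarrow> 0 \<le> t \<Longrightarrow> K (s + t) x = K s x \<bind> K t"
    and K_absorbed: "0 \<le> t \<Longrightarrow> K t cem = return borel cem"
begin

definition U :: "real \<Rightarrow> ('a \<Rightarrow> real) \<Rightarrow> 'a \<Rightarrow> real" where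
  "U t f x = (\<integral>y. f y \<partial>K t x)"

definition S :: "real \<Rightarrow> 'a \<Rightarrow> real" where
  "S t x = measure (K t x) E"

lemma E_borel[measurable]: "E \<in> sets borel"
  unfolding E_eq by (intro borel_open) auto

lemma E_iff: "x \<in> E \<longleftrightarrow> x \<noteq> cem"
  unfolding E_eq by simp

lemma K_prob: "0 \<le> t \<Longrightarrow> prob_space (K t x)"
  and K_sets: "0 \<le> t \<Longrightarrow> sets (K t x) = sets borel"
  using measurable_space[OF K_kernel, of t x] by (auto simp: space_prob_algebra)

lemma K_space: "0 \<le> t \<Longrightarrow> space (K t x) = UNIV"
  using sets_eq_imp_space_eq[OF K_sets] by simp

lemma integrable_K:
  assumes "0 \<le> t" "f \<in> borel_measurable borel" "\<And>x. \<bar>f x\<bar> \<le> B"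
  shows "integrable (K t x) (f :: 'a \<Rightarrow> real)"
proof -
  interpret prob_space "K t x" by (rule K_prob[OF assms(1)])
  show ?thesis using assms
    by (intro integrable_const_bound[where B=B]) (auto simp: measurable_cong_sets[OF K_sets refl])
qed

lemma U_measurable:
  assumes "0 \<le> t" "f \<in> borel_measurable borel"
  shows "U t f \<in> borel_measurable borel"
  unfolding U_def
  by (rule measurable_compose[OF measurable_prob_algebraD[OF K_kernel] integral_measurable_subprob_algebra])
    (use assms in auto)

lemma U_mono:
  assumes "0 \<le> t" "f \<in> borel_measurable borel" "g \<in> borel_measurable borel"
    and "\<And>x. \<bar>f x\<bar> \<le> B" "\<And>x. \<bar>g x\<bar> \<le> B'" "\<And>x. f x \<le> g x"
  shows "U t f x \<le> U t g x"
  unfolding U_def by (intro integral_mono integrable_K[of t _ B] integrable_K[of t _ B'] assms)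

lemma U_const: "0 \<le> t \<Longrightarrow> U t (\<lambda>_. c) x = c"
  unfolding U_def using prob_space.prob_space[OF K_prob, of t x] by simp

lemma U_cmult: "U t (\<lambda>z. c * f z) x = c * U t f x"
  unfolding U_def by simp

lemma U_nonneg: "(\<And>x. 0 \<le> f x) \<Longrightarrow> 0 \<le> U t f x"
  unfolding U_def by (simp add: integral_nonneg_AE)

lemma U_le:
  assumes "0 \<le> t" "f \<in> borel_measurable borel" "\<And>x. 0 \<le> f x" "\<And>x. f x \<le> B"
  shows "U t f x \<le> B"
  using U_mono[of t f "\<lambda>_. B" B "\<bar>B\<bar>" x] U_const[of t B x] assms by auto

lemma U_absorbed: "0 \<le> t \<Longrightarrow> f \<in> borel_measurable borel \<Longrightarrow> U t f cem = f cem"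
  unfolding U_def by (simp add: K_absorbed integral_return)

lemma U_start: "f \<in> borel_measurable borel \<Longrightarrow> U 0 f x = f x"
  unfolding U_def by (simp add: K_start integral_return)

lemma U_indicator: "0 \<le> t \<Longrightarrow> A \<in> sets borel \<Longrightarrow> U t (indicator A) x = measure (K t x) A"
  unfolding U_def by (simp add: K_sets K_space)

lemma U_add:
  assumes "0 \<le> s" "0 \<le> t" "f \<in> borel_measurable borel" "\<And>x. \<bar>f x\<bar> \<le> B"
  shows "U (s + t) f x = U s (U t f) x"
  unfolding U_def K_add[OF assms(1,2)]
proof (rule integral_bind[where K=borel and B=B and B'=1])
  show "K t \<in> K s x \<rightarrow>\<^sub>M subprob_algebra borel"
    using measurable_prob_algebraD[OF K_kernel[OF assms(2)]]
    by (simp add: measurable_cong_sets[OF K_sets[OF assms(1)] refl])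
qed (use assms prob_space.finite_measure[OF K_prob] in
    \<open>auto simp: prob_space.emeasure_space_1[OF K_prob]\<close>)

lemma S_eq: "0 \<le> t \<Longrightarrow> S t = U t (indicator E)"
  unfolding S_def by (rule ext) (simp add: U_indicator)

lemma S_measurable[measurable]: "0 \<le> t \<Longrightarrow> S t \<in> borel_measurable borel"
  by (simp add: S_eq U_measurable)

lemma S_nonneg[simp]: "0 \<le> S t x"
  by (simp add: S_def)

lemma S_le_1: "0 \<le> t \<Longrightarrow> S t x \<le> 1"
  unfolding S_def by (intro prob_space.prob_le_1 K_prob)

lemma S_abs_le: "0 \<le> t \<Longrightarrow> \<bar>S t x\<bar> \<le> 1"
  using S_le_1[of t x] by simp

lemma S_cem: "0 \<le> t \<Longrightarrow> S t cem = 0"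
  by (simp add: S_eq U_absorbed E_iff)

lemma S_start: "x \<in> E \<Longrightarrow> S 0 x = 1"
  by (simp add: S_eq U_start)

lemma S_add: "0 \<le> s \<Longrightarrow> 0 \<le> t \<Longrightarrow> S (s + t) x = U s (S t) x"
  by (simp add: S_eq U_add[where B=1])

lemma S_le_indicator: "0 \<le> t \<Longrightarrow> S t x \<le> indicator E x"
  using S_cem[of t] S_le_1[of t x] by (cases "x \<in> E") (auto simp: E_iff)

lemma S_antimono:
  assumes "0 \<le> s" "s \<le> t"
  shows "S t x \<le> S s x"
proof -
  have "S t x = U s (S (t - s)) x" using S_add[of s "t - s" x] assms by simp
  also have "\<dots> \<le> U s (indicator E) x"
    using assms by (intro U_mono[of s _ _ 1 1]) (auto simp: S_le_1 S_le_indicator)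
  finally show ?thesis using assms by (simp add: S_eq)
qed

lemma integrable_S:
  assumes "prob_space \<mu>" "sets \<mu> = sets borel" "0 \<le> t"
  shows "integrable \<mu> (S t)"
proof -
  interpret prob_space \<mu> by fact
  show ?thesis using assms
    by (intro integrable_const_bound[where B=1]) (auto simp: S_le_1 measurable_cong_sets[OF assms(2) refl])
qed

end

section \<open>Contraction of the conditioned semigroup\<close>

text \<open>
  Condition (A) in terms of the kernels; in \<open>A1\<close> the conditioning is multiplied out.
\<close>

locale conditioned_kernels = absorbed_kernels +
  fixes t0 c1 c2 :: real and \<nu> :: "'a measure"
  assumes S_pos: "\<And>x t. x \<in> E \<Longrightarrow> 0 \<le> t \<Longrightarrow> 0 < S t x"
    and E_ne: "E \<noteq> {}"
    and t0: "0 < t0" and c1: "0 < c1" and c2: "0 < c2"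
    and \<nu>: "prob_measure_on E \<nu>"
    and A1: "\<And>x A. x \<in> E \<Longrightarrow> A \<in> sets borel \<Longrightarrow> c1 * S t0 x * measure \<nu> A \<le> measure (K t0 x) A"
    and A2: "\<And>z t. 0 \<le> t \<Longrightarrow> c2 * S t z \<le> (\<integral>y. S t y \<partial>\<nu>)"
begin

lemma \<nu>_prob: "prob_space \<nu>" and \<nu>_sets: "sets \<nu> = sets borel" and \<nu>_E: "measure \<nu> E = 1"
  using \<nu> by (auto simp: prob_measure_on_def)

lemma integral_S_pos:
  assumes \<mu>: "prob_measure_on E \<mu>" and t: "0 \<le> t"
  shows "0 < (\<integral>x. S t x \<partial>\<mu>)"
  using integrable_S[OF _ _ t] \<mu> S_pos[OF _ t]
  by (intro integral_pos_of_pos_on[OF \<mu>]) (auto simp: prob_measure_on_def)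

definition c where "c = c1 * c2"

lemma c_pos: "0 < c" unfolding c_def using c1 c2 by simp

lemma c_le_1: "c \<le> 1"
proof -
  obtain x where x: "x \<in> E" using E_ne by blast
  have "c1 * S t0 x * 1 \<le> S t0 x" using A1[OF x E_borel] \<nu>_E by (simp add: S_def)
  then have "c1 \<le> 1" using S_pos[OF x, of t0] t0 by simp
  moreover have "(\<integral>y. S 0 y \<partial>\<nu>) \<le> 1"
    using prob_space.integral_le_const[OF \<nu>_prob integrable_S[OF \<nu>_prob \<nu>_sets, of 0], of 1]
    by (simp add: S_le_1)
  then have "c2 \<le> 1" using A2[of 0 x] S_start[OF x] by simp
  ultimately show ?thesis unfolding c_def using c1 c2 by (simp add: mult_le_one)
qed

lemma A1_integral:
  assumes "x \<in> E" "f \<in> borel_measurable borel" "\<And>z. 0 \<le> f z" "\<And>z. f z \<le> B"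
  shows "c1 * S t0 x * (\<integral>y. f y \<partial>\<nu>) \<le> U t0 f x"
  unfolding U_def
proof (rule integral_mono_of_measure_le[where B=B])
  show "finite_measure (K t0 x)" "finite_measure \<nu>"
    using K_prob t0 \<nu>_prob by (auto simp: prob_space.finite_measure)
qed (use assms t0 K_sets \<nu>_sets c1 A1 in \<open>auto simp: measurable_cong_sets[OF K_sets refl]\<close>)

text \<open>
  The kernel \<open>g \<mapsto> U t0 (g * S v) x / S (t0 + v) x\<close> is the law at time \<open>t0\<close> of the process conditioned
  to survive until the later time \<open>t0 + v\<close>. It inherits from \<open>A1\<close> a minorization whose constant does
  not depend on \<open>v\<close>: the measure \<open>\<nu>\<close> is reweighted by \<open>S v\<close>, and \<open>A2\<close> bounds \<open>S (t0 + v) x\<close>, which is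
  \<open>U t0 (S v) x\<close>, by a multiple of \<open>S t0 x\<close> times the \<open>\<nu>\<close>-integral of \<open>S v\<close>.
\<close>

lemma doeblin_minorization:
  assumes x: "x \<in> E" and v: "0 \<le> v" and g: "g \<in> borel_measurable borel"
    and g0: "\<And>z. z \<in> E \<Longrightarrow> 0 \<le> g z" and gB: "\<And>z. \<bar>g z\<bar> \<le> B"
  shows "c * S (t0 + v) x * ((\<integral>y. g y * S v y \<partial>\<nu>) / (\<integral>y. S v y \<partial>\<nu>)) \<le> U t0 (\<lambda>z. g z * S v z) x"
proof -
  let ?w = "\<integral>y. S v y \<partial>\<nu>"
  have w: "0 < ?w" by (rule integral_S_pos[OF \<nu> v])
  have gS0: "0 \<le> g z * S v z" for z
    using g0[of z] S_cem[OF v] by (cases "z \<in> E") (auto simp: E_iff)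
  have B: "0 \<le> B" using gB[of x] by linarith
  have gSB: "g z * S v z \<le> B" for z
    using mult_mono[OF order_trans[OF abs_ge_self gB[of z]] S_le_1[OF v, of z] B] by simp
  have I: "0 \<le> (\<integral>y. g y * S v y \<partial>\<nu>)" using gS0 by (simp add: integral_nonneg_AE)
  have "S (t0 + v) x = U t0 (S v) x" using t0 v by (simp add: S_add)
  also have "\<dots> \<le> U t0 (\<lambda>z. ?w / c2 * indicator E z) x"
  proof (rule U_mono[where B=1 and B'="?w / c2"])
    show "S v z \<le> ?w / c2 * indicator E z" for z
      using A2[OF v, of z] S_cem[OF v] c2 by (cases "z \<in> E") (auto simp: E_iff field_simps)
  qed (use t0 v w c2 S_abs_le in \<open>auto split: split_indicator\<close>)
  also have "\<dots> = ?w / c2 * S t0 x" unfolding U_cmult S_eq[OF less_imp_le[OF t0]] ..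
  finally have "c * S (t0 + v) x / ?w \<le> c1 * S t0 x"
    unfolding c_def using c1 c2 w by (simp add: field_simps)
  from mult_right_mono[OF this I]
  have "c * S (t0 + v) x * ((\<integral>y. g y * S v y \<partial>\<nu>) / ?w) \<le> c1 * S t0 x * (\<integral>y. g y * S v y \<partial>\<nu>)" by simp
  also have "\<dots> \<le> U t0 (\<lambda>z. g z * S v z) x"
    using g v by (intro A1_integral[OF x _ gS0 gSB]) auto
  finally show ?thesis .
qed

text \<open>
  Doeblin's argument: the common part of mass \<open>c\<close> cancels in the difference of two conditioned laws, so
  that only the fraction \<open>1 - c\<close> of the oscillation is left.
\<close>

lemma contraction_step:
  assumes v: "0 \<le> v" and h: "h \<in> borel_measurable borel" and h0: "\<And>z. 0 \<le> h z" and h1: "\<And>z. h z \<le> 1"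
    and osc: "\<And>x y. x \<in> E \<Longrightarrow> y \<in> E \<Longrightarrow> h x - h y \<le> d" and x: "x \<in> E" and y: "y \<in> E"
  shows "U t0 (\<lambda>z. h z * S v z) x / S (t0 + v) x - U t0 (\<lambda>z. h z * S v z) y / S (t0 + v) y \<le> (1 - c) * d"
proof -
  define hi lo where "hi = (SUP z\<in>E. h z)" and "lo = (INF z\<in>E. h z)"
  have bdd: "bdd_above (h ` E)" "bdd_below (h ` E)"
    using h0 h1 by (auto intro!: bdd_aboveI[of _ 1] bdd_belowI[of _ 0])
  have hl: "h z \<le> hi" "lo \<le> h z" if "z \<in> E" for z
    unfolding hi_def lo_def using bdd that by (auto intro: cSUP_upper cINF_lower)
  have "hi \<le> d + h z" if "z \<in> E" for z
    unfolding hi_def using E_ne osc[OF _ that] by (intro cSUP_least) (auto simp: algebra_simps)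
  then have "hi - d \<le> lo" unfolding lo_def using E_ne by (intro cINF_greatest) (auto simp: algebra_simps)
  then have osc': "(1 - c) * (hi - lo) \<le> (1 - c) * d" using c_le_1 by (intro mult_left_mono) auto
  have hi: "0 \<le> hi" "hi \<le> 1"
    using order_trans[OF h0 hl(1)[OF x]] unfolding hi_def by (auto intro: cSUP_least[OF E_ne h1])
  have lo: "0 \<le> lo" "lo \<le> 1"
    using order_trans[OF hl(2)[OF x] h1] unfolding lo_def by (auto intro: cINF_greatest[OF E_ne h0])
  have centred: "\<bar>hi - h z\<bar> \<le> 1" "\<bar>h z - lo\<bar> \<le> 1" for z
    using h0[of z] h1[of z] hi lo by linarith+
  let ?w = "\<integral>y. S v y \<partial>\<nu>"
  define m where "m = (\<integral>y. h y * S v y \<partial>\<nu>) / ?w"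
  have w: "0 < ?w" by (rule integral_S_pos[OF \<nu> v])
  have hS: "\<bar>h z * S v z\<bar> \<le> 1" "h z * S v z \<le> 1" for z
    using h0[of z] h1[of z] S_le_1[OF v, of z] by (auto simp: abs_mult mult_le_one)
  interpret \<nu>: prob_space \<nu> by (rule \<nu>_prob)
  have i1: "integrable \<nu> (S v)" by (rule integrable_S[OF \<nu>_prob \<nu>_sets v])
  have i2: "integrable \<nu> (\<lambda>z. h z * S v z)" using hS v h
    by (intro \<nu>.integrable_const_bound[where B=1]) (auto simp: measurable_cong_sets[OF \<nu>_sets refl])
  have i3: "integrable (K t0 z) (\<lambda>z. h z * S v z)" "integrable (K t0 z) (S v)" for z
    using t0 v h hS S_abs_le by (auto intro!: integrable_K[of t0 _ 1])
  have up: "U t0 (\<lambda>z. h z * S v z) x / S (t0 + v) x \<le> hi - c * (hi - m)"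
  proof -
    have le: "c * S (t0 + v) x * ((\<integral>y. (hi - h y) * S v y \<partial>\<nu>) / ?w) \<le> U t0 (\<lambda>z. (hi - h z) * S v z) x"
      using h hl centred by (intro doeblin_minorization[OF x v, where B=1]) auto
    have e1: "(\<integral>y. (hi - h y) * S v y \<partial>\<nu>) / ?w = hi - m"
      using i1 i2 w by (simp add: left_diff_distrib m_def diff_divide_distrib)
    have e2: "U t0 (\<lambda>z. (hi - h z) * S v z) x = hi * S (t0 + v) x - U t0 (\<lambda>z. h z * S v z) x"
      using i3 t0 v by (simp add: left_diff_distrib S_add U_def)
    have "0 < S (t0 + v) x" using S_pos[OF x] t0 v by simp
    show ?thesis unfolding pos_divide_le_eq[OF \<open>0 < S (t0 + v) x\<close>]
      using le[unfolded e1 e2] by (simp add: algebra_simps)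
  qed
  have down: "lo + c * (m - lo) \<le> U t0 (\<lambda>z. h z * S v z) y / S (t0 + v) y"
  proof -
    have le: "c * S (t0 + v) y * ((\<integral>y. (h y - lo) * S v y \<partial>\<nu>) / ?w) \<le> U t0 (\<lambda>z. (h z - lo) * S v z) y"
      using h hl centred by (intro doeblin_minorization[OF y v, where B=1]) auto
    have e1: "(\<integral>y. (h y - lo) * S v y \<partial>\<nu>) / ?w = m - lo"
      using i1 i2 w by (simp add: left_diff_distrib m_def diff_divide_distrib)
    have e2: "U t0 (\<lambda>z. (h z - lo) * S v z) y = U t0 (\<lambda>z. h z * S v z) y - lo * S (t0 + v) y"
      using i3 t0 v by (simp add: left_diff_distrib S_add U_def)
    have "0 < S (t0 + v) y" using S_pos[OF y] t0 v by simp
    show ?thesis unfolding pos_le_divide_eq[OF \<open>0 < S (t0 + v) y\<close>]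
      using le[unfolded e1 e2] by (simp add: algebra_simps)
  qed
  from up down osc' show ?thesis by (simp add: algebra_simps)
qed

text \<open>
  The conditioned law at time \<open>t0 + v\<close> is obtained by applying the kernel of \<open>doeblin_minorization\<close> to
  \<open>h = U v F / S v\<close>, which is the conditional expectation of \<open>F\<close> over the remaining time \<open>v\<close>; the
  oscillation thus shrinks by \<open>1 - c\<close> with each period \<open>t0\<close>. The remainder \<open>u\<close> covers the times that
  are not multiples of \<open>t0\<close>.
\<close>

lemma contraction:
  assumes u: "0 \<le> u" and F: "F \<in> borel_measurable borel" and F0: "\<And>z. 0 \<le> F z" and F1: "\<And>z. F z \<le> indicator E z"
    and "x \<in> E" "y \<in> E"
  shows "U (real n * t0 + u) F x / S (real n * t0 + u) x - U (real n * t0 + u) F y / S (real n * t0 + u) y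
    \<le> (1 - c) ^ n"
  using \<open>x \<in> E\<close> \<open>y \<in> E\<close>
proof (induction n arbitrary: x y)
  have F1': "\<bar>F z\<bar> \<le> 1" for z using F0[of z] F1[of z] by (auto split: split_indicator_asm)
  have range: "0 \<le> U v F z \<and> U v F z \<le> S v z" if "0 \<le> v" for v z
    using that F F0 F1 by (auto simp: S_eq U_nonneg intro!: U_mono[of v _ _ 1 1] F1')
  {
    case 0
    have "U u F x / S u x \<le> 1" "0 \<le> U u F y / S u y"
      using range[OF u, of x] range[OF u, of y] S_pos[OF 0(1) u] S_pos[OF 0(2) u] by auto
    then show ?case by simp
  next
    case (Suc n)
    define v where "v = real n * t0 + u"
    have v: "0 \<le> v" unfolding v_def using t0 u by simp
    have t: "real (Suc n) * t0 + u = t0 + v" unfolding v_def by (simp add: algebra_simps)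
    define h where "h z = U v F z / S v z" for z
    \<comment> \<open>Where \<open>S v\<close> vanishes, in particular at \<open>cem\<close>, so does \<open>U v F\<close>.\<close>
    have hS: "h z * S v z = U v F z" for z
      using range[OF v, of z] by (cases "S v z = 0") (auto simp: h_def)
    have "h z \<le> 1" for z
      using range[OF v, of z] by (cases "S v z = 0") (auto simp: h_def divide_le_eq_1 less_le)
    then have "U t0 (\<lambda>z. h z * S v z) x / S (t0 + v) x - U t0 (\<lambda>z. h z * S v z) y / S (t0 + v) y
        \<le> (1 - c) * (1 - c) ^ n"
      using range[OF v] v F Suc U_measurable[OF v F] unfolding v_def[symmetric]
      by (intro contraction_step) (auto simp: h_def)
    then show ?case unfolding t hS using U_add[of t0 v F 1] t0 v F F1' by simp
  }
qed

text \<open>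
  A bound for the oscillation left after the \<open>\<lfloor>t / t0\<rfloor>\<close> complete periods before time \<open>t\<close>.
\<close>

definition \<epsilon> :: "real \<Rightarrow> real" where
  "\<epsilon> t = (1 - c) ^ nat \<lfloor>t / t0\<rfloor>"

lemma \<epsilon>_nonneg: "0 \<le> \<epsilon> t"
  unfolding \<epsilon>_def using c_le_1 by simp

text \<open>
  Replacing the factor \<open>1 - c\<close> by \<open>\<kappa> = max (1 - c) (1 / 2)\<close> covers the case \<open>c = 1\<close>, where the logarithm
  would not exist, and bounds by \<open>2\<close> the factor \<open>1 / \<kappa>\<close> that rounding down to complete periods costs.
\<close>

lemma \<epsilon>_exponential: "\<exists>\<gamma>>0. \<forall>t\<ge>0. \<epsilon> t \<le> 2 * exp (- \<gamma> * t)"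
proof -
  define \<kappa> where "\<kappa> = max (1 - c) (1 / 2)"
  have \<kappa>: "1 / 2 \<le> \<kappa>" "\<kappa> < 1" "1 - c \<le> \<kappa>" unfolding \<kappa>_def using c_pos by auto
  have ln: "ln \<kappa> < 0" using \<kappa> by simp
  have "\<epsilon> t \<le> 2 * exp (- (- ln \<kappa> / t0) * t)" if "0 \<le> t" for t
  proof -
    define n where "n = nat \<lfloor>t / t0\<rfloor>"
    have n: "t / t0 - 1 \<le> real n" using that t0 unfolding n_def by linarith
    have "\<epsilon> t \<le> \<kappa> ^ n" unfolding \<epsilon>_def n_def using \<kappa>(3) c_le_1 by (intro power_mono) auto
    also have "\<dots> = exp (real n * ln \<kappa>)" using \<kappa> by (simp add: exp_of_nat_mult)
    also have "\<dots> \<le> exp ((t / t0 - 1) * ln \<kappa>)" using n ln by (simp add: mult_right_mono_neg)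
    also have "\<dots> = exp (- (- ln \<kappa> / t0) * t) * inverse (exp (ln \<kappa>))"
      by (simp add: exp_minus[symmetric] exp_add[symmetric] algebra_simps)
    also have "\<dots> = exp (- (- ln \<kappa> / t0) * t) * inverse \<kappa>" using \<kappa> by simp
    also have "\<dots> \<le> exp (- (- ln \<kappa> / t0) * t) * 2"
      using \<kappa> by (intro mult_left_mono) (auto simp: field_simps)
    finally show ?thesis by simp
  qed
  moreover have "0 < - ln \<kappa> / t0" using ln t0 by (simp add: divide_neg_pos)
  ultimately show ?thesis by blast
qed

lemma ratio_oscillation:
  assumes t: "0 \<le> t" and F: "F \<in> borel_measurable borel" "\<And>z. 0 \<le> F z" "\<And>z. F z \<le> indicator E z"
    and xy: "x \<in> E" "y \<in> E"
  shows "\<bar>U t F x / S t x - U t F y / S t y\<bar> \<le> \<epsilon> t"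
proof -
  define n where "n = nat \<lfloor>t / t0\<rfloor>"
  have "real n \<le> t / t0" unfolding n_def using t t0 by (simp add: of_nat_nat)
  then have u: "0 \<le> t - real n * t0" using t0 by (simp add: field_simps)
  show ?thesis
    using contraction[OF u F xy, of n] contraction[OF u F xy(2,1), of n] by (simp add: \<epsilon>_def n_def abs_le_iff)
qed

lemma U_range:
  assumes "0 \<le> t" "F \<in> borel_measurable borel" "\<And>z. 0 \<le> F z" "\<And>z. F z \<le> indicator E z"
  shows "0 \<le> U t F z" "U t F z \<le> S t z"
proof -
  have "\<bar>F y\<bar> \<le> 1" for y using assms(3,4)[of y] by (auto split: split_indicator_asm)
  then show "U t F z \<le> S t z" unfolding S_eq[OF assms(1)] using assms by (intro U_mono[of t _ _ 1 1]) auto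
qed (rule U_nonneg[OF assms(3)])

lemma integrable_U:
  assumes "prob_space \<mu>" "sets \<mu> = sets borel"
    and "0 \<le> t" "F \<in> borel_measurable borel" "\<And>z. 0 \<le> F z" "\<And>z. F z \<le> indicator E z"
  shows "integrable \<mu> (U t F)"
proof -
  have b: "0 \<le> U t F z" "U t F z \<le> 1" for z using U_range[OF assms(3-6), of z] S_le_1[OF assms(3), of z] by auto
  interpret prob_space \<mu> by fact
  show ?thesis using b assms
    by (intro integrable_const_bound[where B=1]) (auto simp: U_measurable measurable_cong_sets[OF assms(2) refl])
qed

text \<open>
  The estimate behind all comparisons. The quotient of the two integrals is the conditional law from
  \<open>\<mu>\<close>, a weighted average of the ratios \<open>U t F x / S t x\<close>, hence within their oscillation of each of
  them. Multiplied by \<open>S t z\<close>, the bound becomes linear in the initial point and can be integrated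
  against any measure.
\<close>

lemma centred_bound:
  assumes \<mu>: "prob_measure_on E \<mu>"
    and t: "0 \<le> t" and F: "F \<in> borel_measurable borel" "\<And>z. 0 \<le> F z" "\<And>z. F z \<le> indicator E z"
  shows "\<bar>U t F z - (\<integral>x. U t F x \<partial>\<mu>) / (\<integral>x. S t x \<partial>\<mu>) * S t z\<bar> \<le> \<epsilon> t * S t z"
proof (cases "z \<in> E")
  case False
  then have "z = cem" by (simp add: E_iff)
  then show ?thesis using S_cem[OF t] U_range[OF t F, of cem] by auto
next
  case z: True
  have \<mu>': "prob_space \<mu>" "sets \<mu> = sets borel" using \<mu> by (auto simp: prob_measure_on_def)
  let ?w = "\<integral>x. S t x \<partial>\<mu>" and ?I = "\<integral>x. U t F x \<partial>\<mu>"
  define R where "R = U t F z / S t z"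
  have w: "0 < ?w" by (rule integral_S_pos[OF \<mu> t])
  have Sz: "0 < S t z" by (rule S_pos[OF z t])
  have pw: "(R - \<epsilon> t) * S t y \<le> U t F y \<and> U t F y \<le> (R + \<epsilon> t) * S t y" for y
  proof (cases "y \<in> E")
    case False
    then have "y = cem" by (simp add: E_iff)
    then show ?thesis using S_cem[OF t] U_range[OF t F, of cem] by auto
  next
    case True
    have "0 < S t y" by (rule S_pos[OF True t])
    moreover have "\<bar>R - U t F y / S t y\<bar> \<le> \<epsilon> t" unfolding R_def by (rule ratio_oscillation[OF t F z True])
    ultimately show ?thesis by (simp add: abs_le_iff field_simps)
  qed
  have iS: "integrable \<mu> (S t)" and iU: "integrable \<mu> (U t F)"
    using integrable_S[OF \<mu>' t] integrable_U[OF \<mu>' t F] by auto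
  have "(\<integral>y. (R - \<epsilon> t) * S t y \<partial>\<mu>) \<le> ?I" "?I \<le> (\<integral>y. (R + \<epsilon> t) * S t y \<partial>\<mu>)"
    by (intro integral_mono; use pw iS iU in auto)+
  then have "\<bar>R - ?I / ?w\<bar> \<le> \<epsilon> t"
    unfolding Bochner_Integration.integral_mult_right_zero using w by (simp add: abs_le_iff field_simps)
  from mult_right_mono[OF this, of "S t z"] Sz
  have "\<bar>(R - ?I / ?w) * S t z\<bar> \<le> \<epsilon> t * S t z" by (simp add: abs_mult)
  moreover have "R * S t z = U t F z" unfolding R_def using Sz by simp
  ultimately show ?thesis by (simp add: left_diff_distrib)
qed

end

section \<open>Conditional laws and their limit\<close>

context conditioned_kernels
begin

text \<open>
  The law of the process at time \<open>t\<close> with initial distribution \<open>\<mu>\<close>, conditioned on survival.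
\<close>

definition \<Phi> :: "'a measure \<Rightarrow> real \<Rightarrow> 'a set \<Rightarrow> real" where
  "\<Phi> \<mu> t A = (\<integral>x. measure (K t x) (A \<inter> E) \<partial>\<mu>) / (\<integral>x. S t x \<partial>\<mu>)"

lemma indicator_inter_E:
  assumes "A \<in> sets borel"
  shows "(indicator (A \<inter> E) :: 'a \<Rightarrow> real) \<in> borel_measurable borel"
    "0 \<le> (indicator (A \<inter> E) z :: real)" "(indicator (A \<inter> E) z :: real) \<le> indicator E z"
  using assms by (auto split: split_indicator)

lemma \<Phi>_eq: "0 \<le> t \<Longrightarrow> A \<in> sets borel \<Longrightarrow>
    \<Phi> \<mu> t A = (\<integral>x. U t (indicator (A \<inter> E)) x \<partial>\<mu>) / (\<integral>x. S t x \<partial>\<mu>)"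
  unfolding \<Phi>_def by (simp add: U_indicator)

lemma \<Phi>_is_measure:
  assumes \<mu>: "prob_measure_on E \<mu>" and t: "0 \<le> t"
  shows "\<exists>N. prob_measure_on E N \<and> (\<forall>A\<in>sets borel. \<Phi> \<mu> t A = measure N A)"
proof -
  have \<mu>': "prob_space \<mu>" "sets \<mu> = sets borel" using \<mu> by (auto simp: prob_measure_on_def)
  then have in_alg: "\<mu> \<in> space (prob_algebra borel)" by (simp add: space_prob_algebra)
  interpret \<mu>: prob_space \<mu> by fact
  define L where "L = \<mu> \<bind> K t"
  have L: "prob_space L" "sets L = sets borel"
    unfolding L_def using prob_space_bind'[OF in_alg K_kernel[OF t]] sets_bind'[OF in_alg K_kernel[OF t]] by auto
  have "K t \<in> \<mu> \<rightarrow>\<^sub>M subprob_algebra borel"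
    using measurable_prob_algebraD[OF K_kernel[OF t]] by (simp add: measurable_cong_sets[OF \<mu>'(2) refl])
  then have mL: "measure L A = (\<integral>x. measure (K t x) A \<partial>\<mu>)" if "A \<in> sets borel" for A
    unfolding L_def using that by (rule \<mu>.measure_bind)
  have pos: "0 < measure L E" using integral_S_pos[OF \<mu> t] mL[OF E_borel] by (simp add: S_def[abs_def])
  interpret L: prob_space L by fact
  define N where "N = uniform_measure L E"
  have eE: "emeasure L E \<noteq> 0" using pos by (simp add: L.emeasure_eq_measure)
  have mN: "measure N A = \<Phi> \<mu> t A" if A: "A \<in> sets borel" for A
    unfolding N_def \<Phi>_def S_def[abs_def] using eE A L mL[of "A \<inter> E"] mL[OF E_borel]
    by (subst measure_uniform_measure) (auto simp: L.emeasure_eq_measure Int_commute)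
  have "prob_space N" unfolding N_def using eE by (intro prob_space_uniform_measure) (auto simp: L.emeasure_eq_measure)
  moreover have "measure N E = 1"
    using mN[OF E_borel] integral_S_pos[OF \<mu> t] unfolding \<Phi>_def by (simp add: S_def[abs_def])
  moreover have "sets N = sets borel" unfolding N_def using L by simp
  ultimately show ?thesis using mN by (intro exI[of _ N]) (auto simp: prob_measure_on_def)
qed

lemma return_on_E: "x \<in> E \<Longrightarrow> prob_measure_on E (return borel x)"
  unfolding prob_measure_on_def by (auto simp: prob_space_return measure_return)

lemma \<Phi>_return: "0 \<le> t \<Longrightarrow> A \<in> sets borel \<Longrightarrow> \<Phi> (return borel x) t A = U t (indicator (A \<inter> E)) x / S t x"
  by (simp add: \<Phi>_eq integral_return U_measurable)

lemma \<Phi>_diff_le: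
  assumes \<mu>1: "prob_measure_on E \<mu>1" and \<mu>2: "prob_measure_on E \<mu>2" and t: "0 \<le> t" and A: "A \<in> sets borel"
  shows "\<bar>\<Phi> \<mu>1 t A - \<Phi> \<mu>2 t A\<bar> \<le> \<epsilon> t"
proof -
  note F = indicator_inter_E[OF A]
  define F where "F = (indicator (A \<inter> E) :: 'a \<Rightarrow> real)"
  note F = F[folded F_def]
  have \<mu>1': "prob_space \<mu>1" "sets \<mu>1 = sets borel" using \<mu>1 by (auto simp: prob_measure_on_def)
  interpret prob_space \<mu>1 by fact
  let ?m = "\<Phi> \<mu>2 t A" and ?w = "\<integral>x. S t x \<partial>\<mu>1"
  have w: "0 < ?w" by (rule integral_S_pos[OF \<mu>1 t])
  have pw: "\<bar>U t F z - ?m * S t z\<bar> \<le> \<epsilon> t * S t z" for z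
    using centred_bound[OF \<mu>2 t F, of z] t A by (simp add: \<Phi>_eq F_def)
  have iS: "integrable \<mu>1 (S t)" and iU: "integrable \<mu>1 (U t F)"
    using integrable_S[OF \<mu>1' t] integrable_U[OF \<mu>1' t F] by auto
  have "(?m - \<epsilon> t) * S t z \<le> U t F z" "U t F z \<le> (?m + \<epsilon> t) * S t z" for z
    using pw[of z] by (auto simp: abs_le_iff algebra_simps)
  then have "(\<integral>z. (?m - \<epsilon> t) * S t z \<partial>\<mu>1) \<le> (\<integral>z. U t F z \<partial>\<mu>1)"
    "(\<integral>z. U t F z \<partial>\<mu>1) \<le> (\<integral>z. (?m + \<epsilon> t) * S t z \<partial>\<mu>1)"
    by (intro integral_mono; use iS iU in auto)+
  then show ?thesis
    unfolding \<Phi>_eq[OF t A, of \<mu>1, folded F_def] Bochner_Integration.integral_mult_right_zero using w by (simp add: abs_le_iff field_simps)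
qed

text \<open>
  By the semigroup property, running for \<open>t - s\<close> first and then for \<open>s\<close> only changes the initial
  distribution of the last part of length \<open>s\<close>.
\<close>

lemma \<Phi>_Cauchy:
  assumes x: "x \<in> E" and s: "0 \<le> s" "s \<le> t" and A: "A \<in> sets borel"
  shows "\<bar>\<Phi> (return borel x) s A - \<Phi> (return borel x) t A\<bar> \<le> \<epsilon> s"
proof -
  note F = indicator_inter_E[OF A]
  define F where "F = (indicator (A \<inter> E) :: 'a \<Rightarrow> real)"
  note F = F[folded F_def]
  let ?m = "\<Phi> (return borel x) s A"
  define r where "r = t - s"
  have r: "0 \<le> r" "t = r + s" using s by (auto simp: r_def)
  have t: "0 \<le> t" using s by simp
  have pw: "\<bar>U s F z - ?m * S s z\<bar> \<le> \<epsilon> s * S s z" for z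
    using centred_bound[OF return_on_E[OF x] s(1) F, of z] s A by (simp add: \<Phi>_eq F_def)
  have iS: "integrable (K r x) (S s)" and iU: "integrable (K r x) (U s F)"
    using integrable_S[OF K_prob K_sets] integrable_U[OF K_prob K_sets s(1) F] r(1) s by auto
  have "(?m - \<epsilon> s) * S s z \<le> U s F z" "U s F z \<le> (?m + \<epsilon> s) * S s z" for z
    using pw[of z] by (auto simp: abs_le_iff algebra_simps)
  then have "(\<integral>z. (?m - \<epsilon> s) * S s z \<partial>K r x) \<le> (\<integral>z. U s F z \<partial>K r x)"
    "(\<integral>z. U s F z \<partial>K r x) \<le> (\<integral>z. (?m + \<epsilon> s) * S s z \<partial>K r x)"
    by (intro integral_mono; use iS iU in auto)+
  moreover have "U t F x = (\<integral>z. U s F z \<partial>K r x)"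
    using U_add[OF r(1) s(1) F(1), of 1] F unfolding r by (simp add: U_def F_def)
  moreover have "S t x = (\<integral>z. S s z \<partial>K r x)"
    unfolding r S_add[OF r(1) s(1)] U_def ..
  ultimately show ?thesis
    unfolding \<Phi>_return[OF t A, folded F_def] Bochner_Integration.integral_mult_right_zero
    using S_pos[OF x t] by (simp add: abs_le_iff field_simps)
qed

text \<open>
  The limit is taken along the multiples of \<open>t0\<close> from a single starting point. The factor \<open>2\<close> is the
  sum of two oscillations: one for changing the initial distribution, one for changing the final time.
\<close>

lemma quasi_stationary_limit:
  "\<exists>\<alpha>. prob_measure_on E \<alpha> \<and>
    (\<forall>\<mu> t A. prob_measure_on E \<mu> \<longrightarrow> 0 \<le> t \<longrightarrow> A \<in> sets borel \<longrightarrow> \<bar>\<Phi> \<mu> t A - measure \<alpha> A\<bar> \<le> 2 * \<epsilon> t)"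
proof -
  obtain x where x: "x \<in> E" using E_ne by blast
  note \<delta> = return_on_E[OF x]
  have "\<forall>n. \<exists>N. prob_measure_on E N \<and> (\<forall>A\<in>sets borel. \<Phi> (return borel x) (real n * t0) A = measure N A)"
    using \<Phi>_is_measure[OF \<delta>] t0 by simp
  then obtain N where N: "\<And>n. prob_measure_on E (N n)"
    and \<Phi>N: "\<And>n A. A \<in> sets borel \<Longrightarrow> measure (N n) A = \<Phi> (return borel x) (real n * t0) A"
    by metis
  have "(\<lambda>n. (1 - c) ^ n) \<longlonglongrightarrow> 0" using c_pos c_le_1 by (intro LIMSEQ_power_zero) auto
  moreover have "\<epsilon> (real n * t0) = (1 - c) ^ n" for n using t0 by (simp add: \<epsilon>_def)
  ultimately have lim0: "(\<lambda>n. \<epsilon> (real n * t0)) \<longlonglongrightarrow> 0" by simp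
  have "\<exists>\<alpha>. prob_space \<alpha> \<and> sets \<alpha> = sets (borel :: 'a measure) \<and>
      (\<forall>A\<in>sets borel. (\<lambda>n. measure (N n) A) \<longlonglongrightarrow> measure \<alpha> A)"
  proof (rule ex_limit_of_uniformly_Cauchy_measures[OF _ _ _ lim0])
    show "prob_space (N n)" "sets (N n) = sets borel" for n using N[of n] by (auto simp: prob_measure_on_def)
    show "\<bar>measure (N n) A - measure (N m) A\<bar> \<le> \<epsilon> (real n * t0)" if "n \<le> m" "A \<in> sets borel" for n m A
      unfolding \<Phi>N[OF that(2)] using that t0 by (intro \<Phi>_Cauchy[OF x]) auto
  qed
  then obtain \<alpha> where \<alpha>: "prob_space \<alpha>" "sets \<alpha> = sets (borel :: 'a measure)"
    and lim: "\<And>A. A \<in> sets borel \<Longrightarrow> (\<lambda>n. measure (N n) A) \<longlonglongrightarrow> measure \<alpha> A" by blast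
  have "measure (N n) E = 1" for n using N[of n] by (simp add: prob_measure_on_def)
  then have "measure \<alpha> E = 1" using lim[OF E_borel] by (simp add: LIMSEQ_const_iff)
  then have "prob_measure_on E \<alpha>" using \<alpha> by (simp add: prob_measure_on_def)
  moreover have "\<bar>\<Phi> \<mu> t A - measure \<alpha> A\<bar> \<le> 2 * \<epsilon> t"
    if \<mu>: "prob_measure_on E \<mu>" and t: "0 \<le> t" and A: "A \<in> sets borel" for \<mu> t A
  proof -
    have "(\<lambda>n. \<bar>\<Phi> \<mu> t A - measure (N n) A\<bar>) \<longlonglongrightarrow> \<bar>\<Phi> \<mu> t A - measure \<alpha> A\<bar>"
      by (intro tendsto_intros lim A)
    moreover have "\<bar>\<Phi> \<mu> t A - measure (N n) A\<bar> \<le> 2 * \<epsilon> t" if n: "nat \<lceil>t / t0\<rceil> \<le> n" for n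
    proof -
      have "t / t0 \<le> real n" using n by linarith
      then have "t \<le> real n * t0" using t0 by (simp add: field_simps)
      then show ?thesis
        using \<Phi>_diff_le[OF \<mu> \<delta> t A] \<Phi>_Cauchy[OF x t _ A, of "real n * t0"] unfolding \<Phi>N[OF A]
        by linarith
    qed
    ultimately show ?thesis by (intro LIMSEQ_le_const2) blast+
  qed
  ultimately show ?thesis by blast
qed

text \<open>
  Writing \<open>m = \<Phi> \<mu>2 t A\<close> and \<open>g = U t F - m * S t\<close>, the integral of \<open>g\<close> against \<open>\<mu>2\<close> vanishes, so that
  \<open>\<Phi> \<mu>1 t A - m\<close> is the integral of \<open>g\<close> against \<open>\<mu>1 - \<mu>2\<close> divided by the survival probability from
  \<open>\<mu>1\<close>. By \<open>centred_bound\<close> the numerator is at most a multiple of \<open>\<epsilon> t\<close> times the supremum of \<open>S t\<close>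
  times the distance of the initial distributions. The denominator is at least a multiple of the
  \<open>\<mu>1\<close>-integral of \<open>\<rho>\<close> times the same supremum: from \<open>z\<close> the process is distributed at time \<open>t0\<close> at
  least like \<open>a * \<rho> z * \<nu>\<close>, and by \<open>A2\<close> survival from \<open>\<nu>\<close> is, up to the
  factor \<open>c2\<close>, at least as likely as from any point. The suprema cancel.
\<close>

lemma \<Phi>_diff_lipschitz:
  assumes a: "0 < a" and minor: "\<And>x A. x \<in> E \<Longrightarrow> A \<in> sets borel \<Longrightarrow> a * \<rho> x * measure \<nu> A \<le> measure (K t0 x) A"
    and \<rho>0: "\<And>x. 0 \<le> \<rho> x" and \<rho>_cem: "\<rho> cem = 0" and \<rho>_int: "integrable \<mu>1 \<rho>" "0 < (\<integral>x. \<rho> x \<partial>\<mu>1)"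
    and \<mu>1: "prob_measure_on E \<mu>1" and \<mu>2: "prob_measure_on E \<mu>2" and t: "0 \<le> t" and A: "A \<in> sets borel"
    and d: "\<And>B. B \<in> sets borel \<Longrightarrow> \<bar>measure \<mu>1 B - measure \<mu>2 B\<bar> \<le> d"
  shows "\<bar>\<Phi> \<mu>1 t A - \<Phi> \<mu>2 t A\<bar> \<le> 2 * \<epsilon> t * d / (a * c2 * (\<integral>x. \<rho> x \<partial>\<mu>1))"
proof -
  note F = indicator_inter_E[OF A]
  define F where "F = (indicator (A \<inter> E) :: 'a \<Rightarrow> real)"
  note F = F[folded F_def]
  have \<mu>1': "prob_space \<mu>1" "sets \<mu>1 = sets borel" and \<mu>2': "prob_space \<mu>2" "sets \<mu>2 = sets borel"
    using \<mu>1 \<mu>2 by (auto simp: prob_measure_on_def)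
  let ?m = "\<Phi> \<mu>2 t A" and ?w1 = "\<integral>x. S t x \<partial>\<mu>1" and ?w2 = "\<integral>x. S t x \<partial>\<mu>2" and ?r = "\<integral>x. \<rho> x \<partial>\<mu>1"
  define b where "b = (\<integral>x. S t x \<partial>\<nu>) / c2"
  have w: "0 < ?w1" "0 < ?w2" by (auto intro: integral_S_pos \<mu>1 \<mu>2 t)
  have b: "0 < b" unfolding b_def using integral_S_pos[OF \<nu> t] c2 by simp
  have Sb: "S t z \<le> b" for z unfolding b_def using A2[OF t, of z] c2 by (simp add: field_simps)
  define g where "g z = U t F z - ?m * S t z" for z
  have gm: "g \<in> borel_measurable borel" unfolding g_def using U_measurable[OF t F(1)] t by measurable
  have "\<bar>g z\<bar> \<le> \<epsilon> t * S t z" for z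
    using centred_bound[OF \<mu>2 t F, of z] t A by (simp add: \<Phi>_eq F_def g_def)
  then have gB: "\<bar>g z\<bar> \<le> \<epsilon> t * b" for z
    using mult_left_mono[OF Sb \<epsilon>_nonneg] order_trans by blast
  have int: "(\<integral>z. g z \<partial>\<mu>1) = (\<integral>z. U t F z \<partial>\<mu>1) - ?m * ?w1" "(\<integral>z. g z \<partial>\<mu>2) = (\<integral>z. U t F z \<partial>\<mu>2) - ?m * ?w2"
    unfolding g_def using integrable_S[OF \<mu>1' t] integrable_U[OF \<mu>1' t F] integrable_S[OF \<mu>2' t] integrable_U[OF \<mu>2' t F]
    by auto
  have "\<bar>(\<integral>z. g z \<partial>\<mu>1) - (\<integral>z. g z \<partial>\<mu>2)\<bar> \<le> 2 * (\<epsilon> t * b) * d"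
    using gm gB d \<mu>1' \<mu>2' by (intro integral_diff_le) (auto simp: measurable_cong_sets[OF \<mu>1'(2) refl])
  moreover have "(\<integral>z. g z \<partial>\<mu>2) = 0" unfolding int using w by (simp add: \<Phi>_eq[OF t A] F_def)
  ultimately have num: "\<bar>(\<integral>z. g z \<partial>\<mu>1)\<bar> \<le> 2 * \<epsilon> t * d * b" by (simp add: mult_ac)
  have "a * c2 * b * \<rho> z \<le> S t z" for z
  proof (cases "z \<in> E")
    case False
    then show ?thesis using \<rho>_cem S_nonneg[of t cem] by (simp add: E_iff)
  next
    case True
    have "a * \<rho> z * (\<integral>y. S t y \<partial>\<nu>) \<le> (\<integral>y. S t y \<partial>K t0 z)"
    proof (rule integral_mono_of_measure_le[where B=1])
      show "finite_measure (K t0 z)" "finite_measure \<nu>"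
        using K_prob t0 \<nu>_prob by (auto simp: prob_space.finite_measure)
    qed (use True a \<rho>0 t t0 K_sets \<nu>_sets minor S_le_1[OF t] in \<open>auto simp: measurable_cong_sets[OF K_sets refl]\<close>)
    also have "\<dots> = S (t0 + t) z" using S_add[of t0 t z] t t0 by (simp add: U_def)
    also have "\<dots> \<le> S t z" using t t0 by (intro S_antimono) auto
    finally show ?thesis unfolding b_def using c2 by (simp add: mult_ac)
  qed
  then have "(\<integral>z. a * c2 * b * \<rho> z \<partial>\<mu>1) \<le> ?w1"
    using \<rho>_int integrable_S[OF \<mu>1' t] by (intro integral_mono) auto
  then have den: "a * c2 * ?r * b \<le> ?w1" by (simp add: mult_ac)
  have pos: "0 < a * c2 * ?r * b" using a c2 \<rho>_int b by simp
  have "\<Phi> \<mu>1 t A - ?m = (\<integral>z. g z \<partial>\<mu>1) / ?w1"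
    unfolding int using w by (simp add: \<Phi>_eq[OF t A, of \<mu>1] F_def diff_divide_distrib)
  then have "\<bar>\<Phi> \<mu>1 t A - ?m\<bar> = \<bar>(\<integral>z. g z \<partial>\<mu>1)\<bar> / ?w1" using w by (simp add: abs_divide)
  also have "\<dots> \<le> (2 * \<epsilon> t * d * b) / (a * c2 * ?r * b)"
    using order_trans[OF abs_ge_zero num] num pos den by (rule frac_le)
  also have "\<dots> = 2 * \<epsilon> t * d / (a * c2 * ?r)" using b by simp
  finally show ?thesis .
qed

end

section \<open>Consequences of the gradient estimate\<close>

text \<open>
  The gradient estimate appears as a Lipschitz estimate for nonnegative functions that vanish at the
  cemetery, and the irreducibility assumption through the bound, uniform in \<open>s\<close>, that it yields
  on the one-dimensional laws.
\<close>

locale smoothing_kernels = absorbed_kernels +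
  fixes t1 C :: real
  assumes cpt: "compact (UNIV :: 'a set)" and E_nonempty: "E \<noteq> {}"
    and survival: "\<And>x t. x \<in> E \<Longrightarrow> 0 \<le> t \<Longrightarrow> 0 < S t x"
    and t1: "0 < t1" and C: "0 < C"
    and lipschitz: "\<And>f b x y. f \<in> borel_measurable borel \<Longrightarrow> (\<And>z. 0 \<le> f z) \<Longrightarrow> (\<And>z. f z \<le> b) \<Longrightarrow>
      f cem = 0 \<Longrightarrow> \<bar>U t1 f x - U t1 f y\<bar> \<le> C * b * dist x y"
    and irreducible: "\<And>x y r. x \<in> E \<Longrightarrow> y \<in> E \<Longrightarrow> 0 < r \<Longrightarrow>
      \<exists>\<eta>>0. \<forall>s\<in>{t1..2 * t1}. \<eta> \<le> measure (K s x) (ball y r)"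
begin

text \<open>
  Survival is impossible from the cemetery, so the Lipschitz estimate bounds the survival probability
  by the distance to it.
\<close>

lemma S_le_dist: "S t1 x \<le> C * dist x cem"
  using lipschitz[of "indicator E" 1 x cem] U_absorbed[of t1 "indicator E"] t1 S_eq[of t1]
  by (simp add: E_iff)

text \<open>
  The constant does not grow with \<open>s\<close>: the last \<open>s - t1\<close> units of time turn an indicator into another
  function with values in \<open>[0, 1]\<close>, to which the estimate for the first \<open>t1\<close> units applies. Sets that contain the cemetery cost a second
  \<open>C\<close>, since the mass at the cemetery is one minus the mass on \<open>E\<close>.
\<close>

lemma tv_lipschitz:
  assumes s: "t1 \<le> s" and A: "A \<in> sets borel"
  shows "\<bar>measure (K s x) A - measure (K s y) A\<bar> \<le> 2 * C * dist x y"
proof -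
  have s0: "0 \<le> s" and r: "0 \<le> s - t1" using s t1 by auto
  have onE: "\<bar>measure (K s x) B - measure (K s y) B\<bar> \<le> C * dist x y" if B: "B \<in> sets borel" "B \<subseteq> E" for B
  proof -
    define f where "f = U (s - t1) (indicator B)"
    have Bi: "(indicator B :: 'a \<Rightarrow> real) \<in> borel_measurable borel" using B by simp
    have "U s (indicator B) z = U t1 f z" for z
      using U_add[of t1 "s - t1" "indicator B" 1 z] t1 r Bi by (simp add: f_def)
    moreover have "\<bar>U t1 f x - U t1 f y\<bar> \<le> C * 1 * dist x y"
    proof (rule lipschitz)
      show "f cem = 0" unfolding f_def using U_absorbed[OF r Bi] B(2) E_iff[of cem] by (auto split: split_indicator)
    qed (use r Bi in \<open>auto simp: f_def U_measurable U_nonneg intro!: U_le split: split_indicator\<close>)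
    ultimately show ?thesis using U_indicator[OF s0 B(1)] by simp
  qed
  have split: "measure (K s z) A = measure (K s z) (A \<inter> E) + indicator A cem * (1 - measure (K s z) E)" for z
  proof -
    interpret prob_space "K s z" by (rule K_prob[OF s0])
    have "A \<in> events" "E \<in> events" using A K_sets[OF s0] by auto
    then have "prob A = prob (A \<inter> E) + prob (A - E)"
      by (metis (no_types) add.commute finite_measure_Diff' add_diff_cancel_left' diff_add_cancel)
    moreover have "A - E = (if cem \<in> A then space (K s z) - E else {})"
      using K_space[OF s0] E_iff by auto
    ultimately show ?thesis using prob_compl[OF \<open>E \<in> events\<close>] by (auto split: split_indicator)
  qed
  have "\<bar>measure (K s x) E - measure (K s y) E\<bar> \<le> C * dist x y" by (rule onE) auto
  moreover have "\<bar>measure (K s x) (A \<inter> E) - measure (K s y) (A \<inter> E)\<bar> \<le> C * dist x y"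
    using A by (intro onE) auto
  moreover have "0 \<le> C * dist x y" using C by simp
  ultimately show ?thesis unfolding split[of x] split[of y] by (auto split: split_indicator simp: algebra_simps)
qed

lemma tv_continuous:
  assumes "0 < e"
  shows "\<exists>r>0. \<forall>y\<in>ball x r. \<forall>A\<in>sets borel. \<bar>measure (K t1 y) A - measure (K t1 x) A\<bar> \<le> e"
proof (intro exI conjI ballI)
  show "0 < e / (2 * C)" using assms C by simp
  fix y A assume y: "y \<in> ball x (e / (2 * C))" and A: "A \<in> sets (borel :: 'a measure)"
  have "\<bar>measure (K t1 y) A - measure (K t1 x) A\<bar> \<le> 2 * C * dist y x" by (rule tv_lipschitz[OF order_refl A])
  also have "\<dots> \<le> e" using y C by (simp add: field_simps dist_commute)
  finally show "\<bar>measure (K t1 y) A - measure (K t1 x) A\<bar> \<le> e" .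
qed

text \<open>
  By \<open>tv_lipschitz\<close> the lower bound at a point of \<open>D\<close> persists, up to a factor of two and uniformly in
  \<open>s\<close>, on a ball around it; compactness of \<open>D\<close> leaves finitely many such balls. The bound also holds
  on a neighbourhood of \<open>D\<close>, which matters because \<open>D\<close> is hit at a random time that will be
  approximated by a grid.
\<close>

lemma uniformly_reachable:
  assumes D: "compact D" "D \<subseteq> E" and y: "y \<in> E" and r: "0 < r"
  shows "\<exists>\<eta>>0. \<exists>\<delta>>0. \<forall>s\<in>{t1..2 * t1}. \<forall>x\<in>D. \<forall>z\<in>ball x \<delta>. \<eta> \<le> measure (K s z) (ball y r)"
proof -
  have "\<forall>x\<in>D. \<exists>\<eta>>0. \<forall>s\<in>{t1..2 * t1}. \<eta> \<le> measure (K s x) (ball y r)"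
    using irreducible[OF _ y r] D by blast
  then obtain e where e: "\<And>x. x \<in> D \<Longrightarrow> 0 < e x"
    and ge: "\<And>x s. x \<in> D \<Longrightarrow> s \<in> {t1..2 * t1} \<Longrightarrow> e x \<le> measure (K s x) (ball y r)" by metis
  define \<rho> where "\<rho> x = e x / (4 * C)" for x
  have \<rho>: "0 < \<rho> x" if "x \<in> D" for x using e[OF that] C by (simp add: \<rho>_def)
  obtain F where F: "F \<subseteq> D" "finite F" "D \<subseteq> (\<Union>x\<in>F. ball x (\<rho> x / 2))"
  proof (rule compactE_image[OF D(1), of D "\<lambda>x. ball x (\<rho> x / 2)"])
    show "D \<subseteq> (\<Union>x\<in>D. ball x (\<rho> x / 2))" using \<rho> by fastforce
  qed auto
  define \<eta> \<delta> where "\<eta> = Min (insert 1 ((\<lambda>x. e x / 2) ` F))" and "\<delta> = Min (insert 1 ((\<lambda>x. \<rho> x / 2) ` F))"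
  have "0 < \<eta>" "0 < \<delta>" unfolding \<eta>_def \<delta>_def using F e \<rho> by (auto simp: Min_gr_iff)
  moreover have "\<eta> \<le> measure (K s z) (ball y r)"
    if s: "s \<in> {t1..2 * t1}" and x: "x \<in> D" and z: "z \<in> ball x \<delta>" for s x z
  proof -
    obtain k where k: "k \<in> F" "dist k x < \<rho> k / 2" using F(3) x by fastforce
    have "\<delta> \<le> \<rho> k / 2" unfolding \<delta>_def using F k by (intro Min_le) auto
    then have "dist k z \<le> \<rho> k" using z k(2) dist_triangle[of k z x] by simp
    then have "2 * C * dist k z \<le> e k / 2" unfolding \<rho>_def using C by (simp add: field_simps)
    moreover have "\<bar>measure (K s k) (ball y r) - measure (K s z) (ball y r)\<bar> \<le> 2 * C * dist k z"
      using s by (intro tv_lipschitz) auto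
    moreover have "e k \<le> measure (K s k) (ball y r)" using ge[OF _ s] k F by auto
    moreover have "\<eta> \<le> e k / 2" unfolding \<eta>_def using F k by (intro Min_le) auto
    ultimately show ?thesis by linarith
  qed
  ultimately show ?thesis by blast
qed

text \<open>
  From \<open>x\<close> the process is in the ball around \<open>x0\<close> at time \<open>2 * t1\<close> with a probability of at least a
  multiple of the distance to the cemetery; from there, the local minorization of the two-step kernel
  takes over for another \<open>2 * t1\<close>.
\<close>

lemma minorization_by_distance:
  assumes x0: "x0 \<in> E"
    and return: "\<And>r. 0 < r \<Longrightarrow> \<exists>k>0. \<forall>x\<in>E. k * dist x cem \<le> measure (K (2 * t1) x) (ball x0 r)"
  shows "\<exists>a>0. \<exists>\<nu>. prob_measure_on E \<nu> \<and>
    (\<forall>x\<in>E. \<forall>A\<in>sets borel. a * dist x cem * measure \<nu> A \<le> measure (K (4 * t1) x) A)"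
proof -
  have K2: "K t1 x \<bind> K t1 = K (2 * t1) x" for x using K_add[of t1 t1 x] t1 by simp
  have "0 < measure (K t1 x0 \<bind> K t1) E" unfolding K2 using survival[OF x0, of "2 * t1"] t1 by (simp add: S_def)
  then obtain r c \<nu> where r: "0 < r" and c: "0 < c" and \<nu>: "prob_space \<nu>" "sets \<nu> = sets borel" "measure \<nu> E = 1"
    and minor: "\<And>x A. x \<in> ball x0 r \<Longrightarrow> A \<in> sets borel \<Longrightarrow> c * measure \<nu> A \<le> measure (K (2 * t1) x) A"
    using local_minorization[OF cpt K_kernel tv_continuous E_borel, of x0] t1 unfolding K2 by fastforce
  obtain k where k: "0 < k" and ret: "\<And>x. x \<in> E \<Longrightarrow> k * dist x cem \<le> measure (K (2 * t1) x) (ball x0 r)"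
    using return[OF r] by blast
  have "c * k * dist x cem * measure \<nu> A \<le> measure (K (4 * t1) x) A" if x: "x \<in> E" and A: "A \<in> sets borel" for x A
  proof -
    have Ai: "(indicator A :: 'a \<Rightarrow> real) \<in> borel_measurable borel" using A by simp
    have "c * k * dist x cem * measure \<nu> A \<le> c * measure \<nu> A * measure (K (2 * t1) x) (ball x0 r)"
      using mult_left_mono[OF ret[OF x], of "c * measure \<nu> A"] c by (simp add: mult_ac)
    also have "\<dots> = U (2 * t1) (\<lambda>z. c * measure \<nu> A * indicator (ball x0 r) z) x"
      using t1 by (simp only: U_cmult) (simp add: U_indicator)
    also have "\<dots> \<le> U (2 * t1) (U (2 * t1) (indicator A)) x"
    proof (rule U_mono[where B="c * measure \<nu> A" and B'=1])
      show "c * measure \<nu> A * indicator (ball x0 r) z \<le> U (2 * t1) (indicator A) z" for z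
        using minor[of z A] A t1 by (auto simp: U_indicator split: split_indicator)
      show "\<bar>U (2 * t1) (indicator A) z\<bar> \<le> 1" for z
        using A t1 prob_space.prob_le_1[OF K_prob] by (simp add: U_indicator)
      show "(\<lambda>z. c * measure \<nu> A * indicator (ball x0 r) z) \<in> borel_measurable borel"
        by (intro borel_measurable_times borel_measurable_const borel_measurable_indicator) simp
    qed (use t1 c Ai U_measurable in \<open>auto split: split_indicator\<close>)
    also have "\<dots> = U (4 * t1) (indicator A) x"
      using U_add[of "2 * t1" "2 * t1" "indicator A" 1 x] t1 Ai by simp
    also have "\<dots> = measure (K (4 * t1) x) A" using t1 A by (simp add: U_indicator)
    finally show ?thesis .
  qed
  moreover have "prob_measure_on E \<nu>" using \<nu> by (simp add: prob_measure_on_def)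
  ultimately show ?thesis using c k by (intro exI[of _ "c * k"]) auto
qed

lemma integrable_dist:
  assumes \<mu>: "prob_measure_on E \<mu>"
  shows "integrable \<mu> (\<lambda>x. dist x cem)" "0 < (\<integral>x. dist x cem \<partial>\<mu>)"
proof -
  have \<mu>': "prob_space \<mu>" "sets \<mu> = sets borel" using \<mu> by (auto simp: prob_measure_on_def)
  interpret prob_space \<mu> by fact
  obtain D where D: "\<And>x. dist cem x \<le> D"
    using compact_imp_bounded[OF cpt] bounded_any_center[of UNIV cem] by auto
  show int: "integrable \<mu> (\<lambda>x. dist x cem)"
    using D by (intro integrable_const_bound[where B=D])
      (auto simp: measurable_cong_sets[OF \<mu>'(2) refl] dist_commute intro!: borel_measurable_continuous_onI continuous_intros)
  show "0 < (\<integral>x. dist x cem \<partial>\<mu>)" by (rule integral_pos_of_pos_on[OF \<mu> E_borel int]) (auto simp: E_iff)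
qed

text \<open>
  Write \<open>w t\<close> for the survival probability from \<open>\<nu>\<close>. By the Lipschitz estimate, \<open>S (t1 + u)\<close> varies by
  at most \<open>\<theta> / 2\<close> times the supremum of \<open>S u\<close> on a ball of a fixed radius \<open>\<delta>\<close>. As such a ball is
  reached from \<open>\<nu>\<close> at time \<open>t1\<close> with a probability bounded below, this gives

    \<open>sup S (t1 + u) \<le> w (2 * t1 + u) / q + \<theta> / 2 * sup S u\<close>,

  a recursion in \<open>u\<close> with a contraction factor that can be chosen freely at the price of a small \<open>q\<close>.
  On the other hand, the minorization bounds the decay of \<open>w\<close> by \<open>w (t + t1) \<ge> \<theta> * w t\<close>, where \<open>\<theta>\<close>
  does not depend on \<open>\<delta>\<close>. The recursion thus forgets its past twice as fast as \<open>w\<close> can decay, and by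
  induction \<open>sup S (n * t1)\<close> is at most a constant times \<open>w ((n + 1) * t1)\<close>.
\<close>

lemma survival_comparison:
  assumes a: "0 < a" and \<nu>: "prob_measure_on E \<nu>"
    and minor: "\<And>x A. x \<in> E \<Longrightarrow> A \<in> sets borel \<Longrightarrow> a * dist x cem * measure \<nu> A \<le> measure (K (4 * t1) x) A"
  shows "\<exists>c2>0. \<forall>z. \<forall>t\<ge>0. c2 * S t z \<le> (\<integral>y. S t y \<partial>\<nu>)"
proof -
  have \<nu>': "prob_space \<nu>" "sets \<nu> = sets borel" using \<nu> by (auto simp: prob_measure_on_def)
  interpret \<nu>: prob_space \<nu> by fact
  define w where "w t = (\<integral>y. S t y \<partial>\<nu>)" for t
  have iS: "integrable \<nu> (S t)" if "0 \<le> t" for t by (rule integrable_S[OF \<nu>' that])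
  have w_pos: "0 < w t" if "0 \<le> t" for t unfolding w_def
    using survival[OF _ that] by (intro integral_pos_of_pos_on[OF \<nu> E_borel iS[OF that]]) auto
  have w_anti: "w t \<le> w s" if "0 \<le> s" "s \<le> t" for s t unfolding w_def
    using that by (intro integral_mono iS S_antimono) auto
  define \<theta> where "\<theta> = a * (\<integral>x. dist x cem \<partial>\<nu>)"
  have \<theta>: "0 < \<theta>" unfolding \<theta>_def using a integrable_dist[OF \<nu>] by simp
  have growth: "\<theta> * w t \<le> w (t + t1)" if t: "0 \<le> t" for t
  proof -
    have "a * w t * dist x cem \<le> S (4 * t1 + t) x" for x
    proof (cases "x \<in> E")
      case True
      have "a * dist x cem * w t \<le> (\<integral>y. S t y \<partial>K (4 * t1) x)"
        unfolding w_def
      proof (rule integral_mono_of_measure_le[where B=1])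
        show "finite_measure (K (4 * t1) x)" "finite_measure \<nu>"
          using K_prob t1 \<nu>' by (auto simp: prob_space.finite_measure)
      qed (use True a t t1 K_sets \<nu>' minor S_le_1[OF t] in \<open>auto simp: measurable_cong_sets[OF K_sets refl]\<close>)
      also have "\<dots> = S (4 * t1 + t) x" using S_add[of "4 * t1" t x] t t1 by (simp add: U_def)
      finally show ?thesis by (simp add: mult_ac)
    qed (use S_nonneg[of "4 * t1 + t" x] in \<open>simp add: E_iff\<close>)
    then have "(\<integral>x. a * w t * dist x cem \<partial>\<nu>) \<le> w (4 * t1 + t)"
      unfolding w_def[of "4 * t1 + t"] using t t1 integrable_dist[OF \<nu>] by (intro integral_mono iS) auto
    then have "\<theta> * w t \<le> w (4 * t1 + t)" unfolding \<theta>_def by (simp add: mult_ac)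
    also have "\<dots> \<le> w (t + t1)" using t t1 by (intro w_anti) auto
    finally show ?thesis .
  qed
  define \<delta> where "\<delta> = \<theta> / (4 * C)"
  have \<delta>: "0 < \<delta>" "2 * C * \<delta> = \<theta> / 2" unfolding \<delta>_def using \<theta> C by auto
  obtain k :: "'a set" where k: "finite k" "UNIV \<subseteq> (\<Union>x\<in>k. ball x \<delta>)"
    using cpt \<delta> unfolding compact_eq_totally_bounded by blast
  define p where "p y = (\<integral>x. measure (K t1 x) (ball y \<delta>) \<partial>\<nu>)" for y
  have mK: "(\<lambda>x. measure (K t1 x) B) \<in> borel_measurable borel" if "B \<in> sets borel" for B
  proof -
    have "U t1 (indicator B) = (\<lambda>x. measure (K t1 x) B)" using that t1 by (auto simp: U_indicator)
    then show ?thesis using U_measurable[of t1 "indicator B"] that t1 by simp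
  qed
  have ip: "integrable \<nu> (\<lambda>x. measure (K t1 x) (ball y \<delta>))" for y
    using mK[of "ball y \<delta>"] t1 prob_space.prob_le_1[OF K_prob]
    by (intro \<nu>.integrable_const_bound[where B=1]) (auto simp: measurable_cong_sets[OF \<nu>'(2) refl])
  have p: "0 < p y" if z: "z \<in> E" "z \<in> ball y \<delta>" for y z
    unfolding p_def
  proof (rule integral_pos_of_pos_on[OF \<nu> E_borel ip])
    fix x assume x: "x \<in> E"
    interpret Kx: prob_space "K t1 x" using K_prob t1 by simp
    have "0 < \<delta> - dist y z" using z by simp
    then obtain \<eta> where "0 < \<eta>" "\<eta> \<le> measure (K t1 x) (ball z (\<delta> - dist y z))"
      using irreducible[OF x z(1)] t1 by fastforce
    moreover have "measure (K t1 x) (ball z (\<delta> - dist y z)) \<le> measure (K t1 x) (ball y \<delta>)"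
    proof (rule Kx.finite_measure_mono)
      show "ball z (\<delta> - dist y z) \<subseteq> ball y \<delta>"
      proof
        fix v assume "v \<in> ball z (\<delta> - dist y z)"
        then show "v \<in> ball y \<delta>" using dist_triangle[of y v z] by simp
      qed
    qed (use K_sets t1 in auto)
    ultimately show "0 < measure (K t1 x) (ball y \<delta>)" by linarith
  qed simp
  define I where "I = {y\<in>k. ball y \<delta> \<inter> E \<noteq> {}}"
  define q where "q = Min (insert 1 (p ` I))"
  have I: "finite I" using k by (simp add: I_def)
  have q: "0 < q" unfolding q_def using I p by (auto simp: I_def)
  have step: "S (t1 + u) z \<le> w (t1 + (t1 + u)) / q + \<theta> / 2 * b"
    if u: "0 \<le> u" and b: "\<And>y. S u y \<le> b" for u z b
  proof (cases "z \<in> E")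
    case False
    then have "z = cem" by (simp add: E_iff)
    moreover have "0 \<le> b" using b[of cem] S_cem[OF u] by simp
    ultimately show ?thesis using S_cem[of "t1 + u"] t1 u q \<theta> w_pos[of "t1 + (t1 + u)"]
      by (auto intro!: add_nonneg_nonneg divide_nonneg_nonneg mult_nonneg_nonneg)
  next
    case z: True
    obtain y where y: "y \<in> k" "z \<in> ball y \<delta>" using k(2) by blast
    then have yI: "y \<in> I" using z by (auto simp: I_def)
    have b0: "0 \<le> b" using b[of z] S_nonneg[of u z] by linarith
    define l where "l = S (t1 + u) z - \<theta> / 2 * b"
    have near: "l \<le> S (t1 + u) z'" if "z' \<in> ball y \<delta>" for z'
    proof -
      have "\<bar>U t1 (S u) z - U t1 (S u) z'\<bar> \<le> C * b * dist z z'"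
        using b u by (intro lipschitz) (auto simp: S_cem)
      moreover have "dist z z' \<le> 2 * \<delta>" using y(2) that dist_triangle2[of z z' y] by (auto simp: dist_commute)
      then have "C * b * dist z z' \<le> C * b * (2 * \<delta>)" using C b0 by (intro mult_left_mono) auto
      moreover have "C * b * (2 * \<delta>) = \<theta> / 2 * b" using \<delta>(2) by (metis mult.assoc mult.commute)
      ultimately show ?thesis unfolding l_def using S_add[of t1 u] t1 u by simp
    qed
    have "l \<le> w (t1 + (t1 + u)) / q"
    proof (cases "l \<le> 0")
      case True
      then show ?thesis using w_pos[of "t1 + (t1 + u)"] t1 u q by (auto intro: order_trans divide_nonneg_nonneg)
    next
      case False
      have ball_meas: "(\<lambda>v. l * indicator (ball y \<delta>) v) \<in> borel_measurable borel"
        by (intro borel_measurable_times borel_measurable_const borel_measurable_indicator) simp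
      have "l * measure (K t1 x) (ball y \<delta>) \<le> S (t1 + (t1 + u)) x" for x
      proof -
        have "l * measure (K t1 x) (ball y \<delta>) = U t1 (\<lambda>v. l * indicator (ball y \<delta>) v) x"
          using t1 by (simp only: U_cmult) (simp add: U_indicator)
        also have "\<dots> \<le> U t1 (S (t1 + u)) x"
          using ball_meas False near t1 u S_le_1[of "t1 + u"]
          by (intro U_mono[where B=l and B'=1]) (auto split: split_indicator)
        also have "\<dots> = S (t1 + (t1 + u)) x" using S_add[of t1 "t1 + u" x] t1 u by simp
        finally show ?thesis .
      qed
      then have "(\<integral>x. l * measure (K t1 x) (ball y \<delta>) \<partial>\<nu>) \<le> w (t1 + (t1 + u))"
        unfolding w_def using ip t1 u by (intro integral_mono iS) auto
      then have "l * p y \<le> w (t1 + (t1 + u))" by (simp add: p_def)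
      moreover have "q \<le> p y" unfolding q_def using I yI by (intro Min_le) auto
      then have "l * q \<le> l * p y" using False by (intro mult_left_mono) auto
      ultimately show ?thesis using q by (simp add: field_simps)
    qed
    then show ?thesis unfolding l_def by simp
  qed
  \<comment> \<open>\<open>2 / q\<close> closes the induction step, as \<open>1 / q \<le> D / 2\<close>; \<open>1 / w t1\<close> starts the induction.\<close>
  define D where "D = max (2 / q) (1 / w t1)"
  have "2 / q \<le> D" "1 / w t1 \<le> D" unfolding D_def by auto
  moreover have "0 < 2 / q" using q by simp
  ultimately have D: "2 / q \<le> D" "1 / w t1 \<le> D" "0 < D" by linarith+
  have main: "S (real n * t1) z \<le> D * w (real (Suc n) * t1)" for n z
  proof (induction n arbitrary: z)
    case 0
    have "S 0 z \<le> 1" by (rule S_le_1) simp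
    also have "1 \<le> D * w t1" using D(2) w_pos[of t1] t1 by (simp add: field_simps)
    finally show ?case by simp
  next
    case (Suc n)
    define u where "u = real n * t1"
    have u: "0 \<le> u" using t1 by (simp add: u_def)
    have e: "real (Suc n) * t1 = t1 + u" "real (Suc (Suc n)) * t1 = t1 + (t1 + u)" by (auto simp: u_def algebra_simps)
    have W: "0 < w (t1 + (t1 + u))" using t1 u by (intro w_pos) auto
    have "S (t1 + u) z \<le> w (t1 + (t1 + u)) / q + \<theta> / 2 * (D * w (t1 + u))"
      using Suc.IH unfolding e u_def[symmetric] by (intro step u) auto
    also have "\<dots> = w (t1 + (t1 + u)) / q + D / 2 * (\<theta> * w (t1 + u))" by simp
    also have "\<dots> \<le> D / 2 * w (t1 + (t1 + u)) + D / 2 * w (t1 + (t1 + u))"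
    proof (rule add_mono)
      show "w (t1 + (t1 + u)) / q \<le> D / 2 * w (t1 + (t1 + u))"
        using mult_right_mono[OF D(1), of "w (t1 + (t1 + u))"] W by (simp add: mult.commute)
      show "D / 2 * (\<theta> * w (t1 + u)) \<le> D / 2 * w (t1 + (t1 + u))"
        using growth[of "t1 + u"] t1 u D(3) by (intro mult_left_mono) (auto simp: add_ac)
    qed
    also have "\<dots> = D * w (t1 + (t1 + u))" by simp
    finally show ?case unfolding e .
  qed
  have "1 / D * S t z \<le> w t" if t: "0 \<le> t" for t z
  proof -
    define n where "n = nat \<lfloor>t / t1\<rfloor>"
    have "real n \<le> t / t1" "t / t1 \<le> real (Suc n)" unfolding n_def using t t1 by (simp, linarith)
    then have n: "real n * t1 \<le> t" "t \<le> real (Suc n) * t1"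
      using t1 by (simp_all only: pos_le_divide_eq pos_divide_le_eq)
    have "S t z \<le> S (real n * t1) z" using n t1 by (intro S_antimono) auto
    also have "\<dots> \<le> D * w (real (Suc n) * t1)" by (rule main)
    also have "\<dots> \<le> D * w t" using n t D(3) by (intro mult_left_mono w_anti) auto
    finally show ?thesis using D(3) by (simp add: field_simps)
  qed
  then show ?thesis using D(3) unfolding w_def by (intro exI[of _ "1 / D"]) auto
qed

text \<open>
  The upper bound \<open>S_le_dist\<close> and the minorization are of the same order in the distance to the
  cemetery, so their quotient, the conditional law, is bounded below uniformly up to the boundary.
\<close>

lemma conditioned_kernels_of_minorization:
  assumes a: "0 < a" and \<nu>: "prob_measure_on E \<nu>"
    and minor: "\<And>x A. x \<in> E \<Longrightarrow> A \<in> sets borel \<Longrightarrow> a * dist x cem * measure \<nu> A \<le> measure (K (4 * t1) x) A"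
  shows "\<exists>c2. conditioned_kernels E cem K (4 * t1) (a / C) c2 \<nu>"
proof -
  obtain c2 where c2: "0 < c2" "\<And>z t. 0 \<le> t \<Longrightarrow> c2 * S t z \<le> (\<integral>y. S t y \<partial>\<nu>)"
    using survival_comparison[OF a \<nu> minor] by blast
  have "a / C * S (4 * t1) x * measure \<nu> A \<le> measure (K (4 * t1) x) A"
    if x: "x \<in> E" and A: "A \<in> sets borel" for x A
  proof -
    have "S (4 * t1) x \<le> C * dist x cem"
      using S_antimono[of t1 "4 * t1" x] S_le_dist[of x] t1 by linarith
    then have "a / C * S (4 * t1) x \<le> a * dist x cem"
      using mult_left_mono[of "S (4 * t1) x" "C * dist x cem" "a / C"] a C by simp
    then have "a / C * S (4 * t1) x * measure \<nu> A \<le> a * dist x cem * measure \<nu> A" by (intro mult_right_mono) auto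
    also have "\<dots> \<le> measure (K (4 * t1) x) A" by (rule minor[OF x A])
    finally show ?thesis .
  qed
  then have "conditioned_kernels E cem K (4 * t1) (a / C) c2 \<nu>"
    using survival E_nonempty t1 a C c2 \<nu> by unfold_locales auto
  then show ?thesis ..
qed

end

section \<open>The kernels of an absorbed Markov process\<close>

text \<open>
  For continuous paths and closed sets the infimum in the hitting time is attained
  as soon as it is finite.
\<close>

lemma hitting_time_le_imp_hit:
  fixes X :: "real \<Rightarrow> 'w \<Rightarrow> 'a::t2_space"
  assumes cont: "continuous_on {0..} (\<lambda>t. X t \<omega>)" and D: "closed D" and t: "0 \<le> t"
    and hit: "hitting_time X D \<omega> \<le> ennreal t"
  shows "\<exists>s\<in>{0..t}. X s \<omega> \<in> D"
proof -
  define T where "T = {0..t + 1} \<inter> (\<lambda>s. X s \<omega>) -` D"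
  have "continuous_on {0..t + 1} (\<lambda>s. X s \<omega>)" by (rule continuous_on_subset[OF cont]) auto
  then have "closed T" unfolding T_def by (rule continuous_closed_preimage) (use D in auto)
  then have "compact T" unfolding T_def using compact_Int_closed[of "{0..t + 1}" T] by (simp add: T_def)
  have "T \<noteq> {}"
  proof
    assume "T = {}"
    then have "t + 1 \<le> s" if "0 \<le> s" "X s \<omega> \<in> D" for s using that by (force simp: T_def)
    then have "ennreal (t + 1) \<le> hitting_time X D \<omega>"
      unfolding hitting_time_def by (intro INF_greatest) (auto intro: ennreal_leI)
    then have "ennreal (t + 1) \<le> ennreal t" using hit by (rule order_trans)
    then show False using t by simp
  qed
  then obtain m where m: "m \<in> T" "\<And>s. s \<in> T \<Longrightarrow> m \<le> s"
    using compact_attains_inf[OF \<open>compact T\<close>] by blast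
  have "m \<le> s" if "0 \<le> s" "X s \<omega> \<in> D" for s
    using that m by (cases "s \<le> t + 1") (auto simp: T_def)
  then have "ennreal m \<le> hitting_time X D \<omega>"
    unfolding hitting_time_def by (intro INF_greatest) (auto intro: ennreal_leI)
  then have "ennreal m \<le> ennreal t" using hit by (rule order_trans)
  then show ?thesis using m(1) t by (intro bexI[of _ m]) (auto simp: T_def)
qed

context absorbed_strong_markov
begin

lemma P_prob: "prob_space (P x)" and P_sets: "sets (P x) = sets M"
  using measurable_space[OF P_measurable, of x] by (auto simp: space_prob_algebra)

lemma P_space: "space (P x) = space M"
  by (rule sets_eq_imp_space_eq[OF P_sets])

lemma X_measurable_P: "0 \<le> t \<Longrightarrow> X t \<in> P x \<rightarrow>\<^sub>M borel"
  using X_measurable by (simp add: measurable_cong_sets[OF P_sets refl])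

lemma not_absorbed_iff:
  assumes \<omega>: "\<omega> \<in> space M" and t: "0 \<le> t"
  shows "ennreal t < absorption_time X cem \<omega> \<longleftrightarrow> X t \<omega> \<noteq> cem"
proof
  assume "ennreal t < absorption_time X cem \<omega>"
  then show "X t \<omega> \<noteq> cem"
    unfolding hitting_time_def using t by (auto simp: less_INF_D dest!: less_INF_D[of _ _ _ t])
next
  assume ne: "X t \<omega> \<noteq> cem"
  show "ennreal t < absorption_time X cem \<omega>"
  proof (rule ccontr)
    assume "\<not> ?thesis"
    then obtain s where "s \<in> {0..t}" "X s \<omega> \<in> {cem}"
      using hitting_time_le_imp_hit[where X=X and \<omega>=\<omega> and D="{cem}" and t=t] continuous_paths[OF \<omega>] t
      by (auto simp: not_less)
    then show False using absorbing[OF \<omega>, of s t] ne by auto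
  qed
qed

definition K :: "real \<Rightarrow> 'a \<Rightarrow> 'a measure" where
  "K t x = distr (P x) borel (X t)"

lemma measure_K: "0 \<le> t \<Longrightarrow> A \<in> sets borel \<Longrightarrow> measure (K t x) A = measure (P x) {\<omega>\<in>space M. X t \<omega> \<in> A}"
  unfolding K_def using measure_distr[OF X_measurable_P, of t A x]
  by (simp add: P_space vimage_def Int_def conj_commute)

lemma K_measurable: "0 \<le> t \<Longrightarrow> K t \<in> borel \<rightarrow>\<^sub>M prob_algebra borel"
  unfolding K_def[abs_def]
  by (rule measurable_compose[OF P_measurable measurable_distr_prob_space]) (rule X_measurable)

lemma K_prob_space: "0 \<le> t \<Longrightarrow> prob_space (K t x)" and sets_K: "sets (K t x) = sets borel"
  unfolding K_def by (auto intro!: prob_space.prob_space_distr P_prob X_measurable_P)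

lemma space_natural_filtration: "space (natural_filtration (space M) X t) = space M"
  using filtration.space_F[OF filtration_natural_filtration] .

lemma X_adapted:
  assumes "0 \<le> s" "s \<le> t" "B \<in> sets borel"
  shows "X s -` B \<inter> space M \<in> sets (natural_filtration (space M) X (ennreal t))"
  unfolding natural_filtration_def
  by (subst sets_measure_of) (use assms in \<open>auto intro!: sigma_sets.Basic exI[of _ s] exI[of _ B] ennreal_leI\<close>)

lemma natural_filtration_sub: "sets (natural_filtration (space M) X t) \<subseteq> sets M"
  unfolding natural_filtration_def
  by (subst sets_measure_of) (auto intro!: sets.sigma_sets_subset intro: measurable_sets[OF X_measurable])

text \<open>
  The strong Markov property at a constant time, integrated over an event of the past.
\<close>

lemma markov:
  assumes s: "0 \<le> s" and t: "0 \<le> t" and B: "B \<in> sets borel"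
    and \<Lambda>: "\<Lambda> \<in> sets (natural_filtration (space M) X (ennreal s))"
  shows "measure (P x) (\<Lambda> \<inter> {\<omega>\<in>space M. X (s + t) \<omega> \<in> B})
    = (\<integral>\<omega>. indicator \<Lambda> \<omega> * measure (K t (X s \<omega>)) B \<partial>P x)"
proof -
  interpret P: prob_space "P x" by (rule P_prob)
  define F where "F = natural_filtration (space M) X"
  interpret filtration "space M" F unfolding F_def by (rule filtration_natural_filtration)
  define T where "T = (\<lambda>_ :: 'w. ennreal s)"
  have T: "stopping_time F T" unfolding T_def by (rule stopping_time_const)
  define G where "G = pre_sigma T"
  have sG: "sets G = {A. \<forall>u. {\<omega>\<in>A. T \<omega> \<le> u} \<in> sets (F u)}" unfolding G_def by (rule sets_pre_sigma[OF T])
  have "subalgebra (P x) G"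
    unfolding subalgebra_def
  proof
    show "space G = space (P x)" unfolding G_def by (simp add: space_pre_sigma P_space)
    show "sets G \<subseteq> sets (P x)"
    proof
      fix A assume "A \<in> sets G"
      then have "{\<omega>\<in>A. T \<omega> \<le> ennreal s} \<in> sets (F (ennreal s))" unfolding sG by blast
      then show "A \<in> sets (P x)" using natural_filtration_sub by (auto simp: T_def F_def P_sets)
    qed
  qed
  then interpret finite_measure_subalgebra "P x" G by unfold_locales
  have \<Lambda>G: "\<Lambda> \<in> sets G"
    unfolding sG
  proof (intro CollectI allI)
    fix u show "{\<omega>\<in>\<Lambda>. T \<omega> \<le> u} \<in> sets (F u)"
    proof (cases "ennreal s \<le> u")
      case True
      then show ?thesis using \<Lambda> sets_F_mono[OF True] by (auto simp: T_def F_def)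
    qed (simp add: T_def)
  qed
  have \<Lambda>M: "\<Lambda> \<in> sets (P x)" using \<Lambda> natural_filtration_sub P_sets by blast
  define Y where "Y = {\<omega>\<in>space M. X (s + t) \<omega> \<in> B}"
  have Y: "Y \<in> sets (P x)"
    using measurable_sets[OF X_measurable_P[of "s + t" x] B] s t
    by (simp add: Y_def P_space vimage_def Int_def conj_commute)
  have ae: "AE \<omega> in P x. real_cond_exp (P x) G (indicator Y) \<omega> = measure (K t (X s \<omega>)) B"
    using strong_markov[OF T[unfolded F_def] t B, of x] s
    unfolding Y_def G_def F_def T_def by (simp add: P_space measure_K t B)
  have "measure (P x) (\<Lambda> \<inter> Y) = (\<integral>\<omega>\<in>\<Lambda>. indicator Y \<omega> \<partial>P x)"
    unfolding set_lebesgue_integral_def using \<Lambda>M Y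
    by (simp add: indicator_inter_arith[symmetric])
  also have "\<dots> = (\<integral>\<omega>\<in>\<Lambda>. real_cond_exp (P x) G (indicator Y) \<omega> \<partial>P x)"
    by (rule real_cond_exp_intA[OF _ \<Lambda>G]) (use Y in \<open>simp add: P.emeasure_eq_measure less_top\<close>)
  also have "\<dots> = (\<integral>\<omega>. indicator \<Lambda> \<omega> * measure (K t (X s \<omega>)) B \<partial>P x)"
    unfolding set_lebesgue_integral_def
  proof (rule integral_cong_AE)
    have "(\<lambda>y. measure (K t y) B) \<in> borel_measurable borel"
      by (rule measurable_compose[OF K_measurable measurable_measure_prob_algebra]) (use t B in auto)
    from measurable_compose[OF X_measurable_P[OF s] this]
    show "(\<lambda>\<omega>. indicator \<Lambda> \<omega> * measure (K t (X s \<omega>)) B) \<in> borel_measurable (P x)"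
      using \<Lambda>M by (intro borel_measurable_times) auto
    show "AE \<omega> in P x. indicator \<Lambda> \<omega> *\<^sub>R real_cond_exp (P x) G (indicator Y) \<omega>
        = indicator \<Lambda> \<omega> * measure (K t (X s \<omega>)) B"
      using ae by eventually_elim simp
  qed (use \<Lambda>M in measurable)
  finally show ?thesis unfolding Y_def .
qed

lemma K_Chapman_Kolmogorov:
  assumes s: "0 \<le> s" and t: "0 \<le> t"
  shows "K (s + t) x = K s x \<bind> K t"
proof (rule measure_eqI)
  have in_alg: "K s x \<in> space (prob_algebra borel)" using K_prob_space[OF s] sets_K by (simp add: space_prob_algebra)
  interpret s: prob_space "K s x" by (rule K_prob_space[OF s])
  have b: "prob_space (K s x \<bind> K t)" "sets (K s x \<bind> K t) = sets borel"
    using prob_space_bind'[OF in_alg K_measurable[OF t]] sets_bind'[OF in_alg K_measurable[OF t]] by auto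
  then show "sets (K (s + t) x) = sets (K s x \<bind> K t)" by (simp add: sets_K)
  fix A assume "A \<in> sets (K (s + t) x)"
  then have A: "A \<in> sets borel" by (simp add: sets_K)
  have mK: "(\<lambda>y. measure (K t y) A) \<in> borel_measurable borel"
    by (rule measurable_compose[OF K_measurable measurable_measure_prob_algebra]) (use t A in auto)
  have "space M \<in> sets (natural_filtration (space M) X (ennreal s))"
    using sets.top[of "natural_filtration (space M) X (ennreal s)"] by (simp add: space_natural_filtration)
  from markov[OF s t A this, of x]
  have "measure (K (s + t) x) A = (\<integral>\<omega>. indicator (space M) \<omega> * measure (K t (X s \<omega>)) A \<partial>P x)"
    using measure_K[of "s + t" A x] s t A by (simp add: Int_def)
  also have "\<dots> = (\<integral>\<omega>. measure (K t (X s \<omega>)) A \<partial>P x)"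
    by (intro Bochner_Integration.integral_cong) (auto simp: P_space)
  also have "\<dots> = (\<integral>y. measure (K t y) A \<partial>K s x)"
    unfolding K_def[of s] by (rule integral_distr[symmetric, OF X_measurable_P[OF s] mK])
  also have "\<dots> = measure (K s x \<bind> K t) A"
    using measurable_prob_algebraD[OF K_measurable[OF t]] A
    by (intro s.measure_bind[symmetric, where N=borel]) (auto simp: measurable_cong_sets[OF sets_K refl])
  finally show "emeasure (K (s + t) x) A = emeasure (K s x \<bind> K t) A"
    using K_prob_space[of "s + t" x] b(1) s t
    by (simp add: prob_space.finite_measure finite_measure.emeasure_eq_measure)
qed

lemma K_eq_return:
  assumes t: "0 \<le> t" and ae: "AE \<omega> in P x. X t \<omega> = y"
  shows "K t x = return borel y"
proof -
  interpret prob_space "P x" by (rule P_prob)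
  have "K t x = distr (P x) borel (\<lambda>_. y)"
    unfolding K_def using ae X_measurable_P[OF t] by (intro distr_cong_AE) auto
  then show ?thesis by (simp add: distr_const)
qed

lemma kernels_of_process: "absorbed_kernels E cem K"
proof
  show "E = - {cem}" using E_cem by auto
  show "K t cem = return borel cem" if "0 \<le> t" for t
  proof (rule K_eq_return[OF that])
    show "AE \<omega> in P cem. X t \<omega> = cem"
      using initial[of cem] AE_space[of "P cem"]
      by eventually_elim (use absorbing[of _ 0 t] that in \<open>auto simp: P_space\<close>)
  qed
qed (auto intro: K_measurable K_Chapman_Kolmogorov K_eq_return initial)

sublocale absorbed_kernels E cem K
  by (rule kernels_of_process)

lemma dirichlet_semigroup_eq:
  assumes "0 \<le> t" "f \<in> borel_measurable borel" "f cem = 0"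
  shows "dirichlet_semigroup P X cem t f x = U t f x"
proof -
  have "dirichlet_semigroup P X cem t f x = (\<integral>\<omega>. f (X t \<omega>) \<partial>P x)"
    unfolding dirichlet_semigroup_def using assms not_absorbed_iff
    by (intro Bochner_Integration.integral_cong) (auto simp: P_space indicator_def)
  then show ?thesis unfolding U_def K_def using integral_distr[OF X_measurable_P[OF assms(1)] assms(2)] by simp
qed

lemma bind_P:
  assumes \<mu>: "prob_measure_on E \<mu>"
  shows "space (\<mu> \<bind> P) = space M"
    and "0 \<le> t \<Longrightarrow> A \<in> sets borel \<Longrightarrow>
      measure (\<mu> \<bind> P) {\<omega>\<in>space M. X t \<omega> \<in> A} = (\<integral>x. measure (K t x) A \<partial>\<mu>)"
proof -
  have \<mu>': "prob_space \<mu>" "sets \<mu> = sets borel" using \<mu> by (auto simp: prob_measure_on_def)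
  then have in_alg: "\<mu> \<in> space (prob_algebra borel)" by (simp add: space_prob_algebra)
  interpret prob_space \<mu> by fact
  show "space (\<mu> \<bind> P) = space M"
    using sets_eq_imp_space_eq[OF sets_bind'[OF in_alg P_measurable]] .
  assume t: "0 \<le> t" and A: "A \<in> sets borel"
  have "{\<omega>\<in>space M. X t \<omega> \<in> A} \<in> sets M"
    using measurable_sets[OF X_measurable[OF t] A] by (simp add: vimage_def Int_def conj_commute)
  moreover have "P \<in> \<mu> \<rightarrow>\<^sub>M subprob_algebra M"
    using measurable_prob_algebraD[OF P_measurable] by (simp add: measurable_cong_sets[OF \<mu>'(2) refl])
  ultimately show "measure (\<mu> \<bind> P) {\<omega>\<in>space M. X t \<omega> \<in> A} = (\<integral>x. measure (K t x) A \<partial>\<mu>)"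
    using measure_bind[of P M] t A by (simp add: measure_K)
qed

lemma survival_event:
  assumes "space Q = space M" "0 \<le> t"
  shows "{\<omega>\<in>space Q. ennreal t < absorption_time X cem \<omega>} = {\<omega>\<in>space M. X t \<omega> \<in> E}"
  using assms not_absorbed_iff by (auto simp: E_iff)

lemma conditional_law_eq:
  assumes Q: "space Q = space M" and t: "0 \<le> t"
  shows "conditional_law Q X cem t A
    = measure Q {\<omega>\<in>space M. X t \<omega> \<in> A \<inter> E} / measure Q {\<omega>\<in>space M. X t \<omega> \<in> E}"
proof -
  have "{\<omega>\<in>space Q. X t \<omega> \<in> A \<and> ennreal t < absorption_time X cem \<omega>} = {\<omega>\<in>space M. X t \<omega> \<in> A \<inter> E}"
    using Q t not_absorbed_iff by (auto simp: E_iff)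
  then show ?thesis unfolding conditional_law_def cond_prob_def survival_event[OF Q t] by simp
qed

text \<open>
  If the set \<open>D\<close> is hit by time \<open>t1\<close>, the time left until \<open>2 * t1\<close> lies between \<open>t1\<close> and \<open>2 * t1\<close>, so
  \<open>B\<close> is reached at time \<open>2 * t1\<close> with probability at least \<open>\<eta>\<close>. The hitting time of \<open>D\<close> is replaced by
  the first time on the grid of mesh \<open>t1 / 2^n\<close> at which the path is in the open \<open>\<delta>\<close>-neighbourhood \<open>V\<close>
  of \<open>D\<close>: this time has finitely many values, so that the Markov property at fixed times applies.
  A continuous path that hits \<open>D\<close> spends an interval of time in \<open>V\<close>, hence is seen there by all fine
  enough grids.
\<close>

lemma hit_then_reach:
  assumes D: "compact D" and t1: "0 < t1" and \<delta>: "0 < \<delta>" and \<eta>: "0 \<le> \<eta>" and B: "B \<in> sets borel"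
    and reach: "\<And>s x z. s \<in> {t1..2 * t1} \<Longrightarrow> x \<in> D \<Longrightarrow> z \<in> ball x \<delta> \<Longrightarrow> \<eta> \<le> measure (K s z) B"
  shows "\<eta> * \<P>(\<omega> in P x. hitting_time X D \<omega> \<le> ennreal t1 \<and> R \<omega>) \<le> measure (K (2 * t1) x) B"
proof -
  interpret P: prob_space "P x" by (rule P_prob)
  define V where "V = (\<Union>x\<in>D. ball x \<delta>)"
  have "open V" unfolding V_def by auto
  then have V: "V \<in> sets borel" by simp
  define G where "G n = {\<omega>\<in>space M. \<exists>k\<le>2^n. X (real k * t1 / 2^n) \<omega> \<in> V}" for n :: nat
  define YB where "YB = {\<omega>\<in>space M. X (2 * t1) \<omega> \<in> B}"
  have YB: "YB \<in> P.events"
    using measurable_sets[OF X_measurable_P[of "2 * t1" x] B] t1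
    by (simp add: YB_def P_space vimage_def Int_def conj_commute)
  have G: "G n \<in> P.events" and bound: "\<eta> * P.prob (G n) \<le> P.prob YB" for n
  proof -
    define \<tau> where "\<tau> k = real k * t1 / 2^n" for k :: nat
    have \<tau>: "0 \<le> \<tau> k" "j \<le> k \<Longrightarrow> \<tau> j \<le> \<tau> k" "k \<le> 2^n \<Longrightarrow> \<tau> k \<le> t1" for j k
      unfolding \<tau>_def using t1 by (auto intro!: divide_right_mono mult_right_mono simp: pos_divide_le_eq mult.commute)
    \<comment> \<open>The event that the grid time \<open>\<tau> k\<close> is the first one with the path in \<open>V\<close>.\<close>
    define H where "H k = (X (\<tau> k) -` V \<inter> space M) - (\<Union>j<k. X (\<tau> j) -` V \<inter> space M)" for k
    have HF: "H k \<in> sets (natural_filtration (space M) X (ennreal (\<tau> k)))" for k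
      unfolding H_def using \<tau> V by (intro sets.Diff sets.finite_UN X_adapted) auto
    then have H: "H k \<in> P.events" for k using natural_filtration_sub P_sets by blast
    have disj: "disjoint_family_on H A" for A
      unfolding disjoint_family_on_def H_def
    proof (intro ballI impI)
      fix i j :: nat assume "i \<noteq> j"
      then consider "i < j" | "j < i" by linarith
      then show "((X (\<tau> i) -` V \<inter> space M) - (\<Union>j<i. X (\<tau> j) -` V \<inter> space M)) \<inter>
          ((X (\<tau> j) -` V \<inter> space M) - (\<Union>i<j. X (\<tau> i) -` V \<inter> space M)) = {}"
        by cases auto
    qed
    have G_eq: "G n = (\<Union>k\<le>2^n. H k)"
    proof
      show "G n \<subseteq> (\<Union>k\<le>2^n. H k)"
      proof
        fix \<omega> assume "\<omega> \<in> G n"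
        then obtain k where k: "\<omega> \<in> space M" "k \<le> 2^n" "X (\<tau> k) \<omega> \<in> V" by (auto simp: G_def \<tau>_def)
        define l where "l = (LEAST k. X (\<tau> k) \<omega> \<in> V)"
        have "X (\<tau> l) \<omega> \<in> V" "l \<le> k" "\<And>j. j < l \<Longrightarrow> X (\<tau> j) \<omega> \<notin> V"
          unfolding l_def using k(3) by (auto intro: LeastI Least_le dest: not_less_Least)
        then show "\<omega> \<in> (\<Union>k\<le>2^n. H k)" using k by (intro UN_I[of l]) (auto simp: H_def)
      qed
    qed (auto simp: G_def H_def \<tau>_def)
    have "P.prob (\<Union>k\<le>2^n. H k) = (\<Sum>k\<le>2^n. P.prob (H k))"
      using H disj by (intro P.finite_measure_finite_Union) auto
    then have sum: "P.prob (G n) = (\<Sum>k\<le>2^n. P.prob (H k))" by (simp add: G_eq)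
    show "G n \<in> P.events" unfolding G_eq using H by auto
    have step: "\<eta> * P.prob (H k) \<le> P.prob (H k \<inter> YB)" if k: "k \<le> 2^n" for k
    proof -
      define s where "s = 2 * t1 - \<tau> k"
      have s: "s \<in> {t1..2 * t1}" "0 \<le> s" "\<tau> k + s = 2 * t1" using \<tau>(1)[of k] \<tau>(3)[OF k] t1 by (auto simp: s_def)
      have mK: "(\<lambda>\<omega>. measure (K s (X (\<tau> k) \<omega>)) B) \<in> borel_measurable (P x)"
        by (rule measurable_compose[OF X_measurable_P measurable_compose[OF K_measurable measurable_measure_prob_algebra]])
          (use s \<tau> B in auto)
      have "\<eta> * P.prob (H k) = (\<integral>\<omega>. indicator (H k) \<omega> * \<eta> \<partial>P x)"
        using H by simp
      also have "\<dots> \<le> (\<integral>\<omega>. indicator (H k) \<omega> * measure (K s (X (\<tau> k) \<omega>)) B \<partial>P x)"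
      proof (rule integral_mono)
        show "integrable (P x) (\<lambda>\<omega>. indicator (H k) \<omega> * \<eta>)"
          using H by (intro integrable_mult_left) (auto simp: P.emeasure_eq_measure less_top)
        show "integrable (P x) (\<lambda>\<omega>. indicator (H k) \<omega> * measure (K s (X (\<tau> k) \<omega>)) B)"
          using H mK prob_space.prob_le_1[OF K_prob_space[OF s(2)]]
          by (intro P.integrable_const_bound[where B=1]) (auto split: split_indicator)
        show "indicator (H k) \<omega> * \<eta> \<le> indicator (H k) \<omega> * measure (K s (X (\<tau> k) \<omega>)) B" for \<omega>
          using reach[OF s(1)] by (auto simp: H_def V_def split: split_indicator)
      qed
      also have "\<dots> = P.prob (H k \<inter> YB)"
        using markov[where x=x and s="\<tau> k" and t=s, OF \<tau>(1) s(2) B HF] unfolding YB_def s(3) by simp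
      finally show ?thesis .
    qed
    have "\<eta> * P.prob (G n) \<le> (\<Sum>k\<le>2^n. P.prob (H k \<inter> YB))"
      unfolding sum sum_distrib_left using step by (intro sum_mono) auto
    also have "\<dots> = P.prob (\<Union>k\<le>2^n. H k \<inter> YB)"
    proof (intro P.finite_measure_finite_Union[symmetric])
      show "disjoint_family_on (\<lambda>k. H k \<inter> YB) {..2^n}"
        using disj[of "{..2^n}"] unfolding disjoint_family_on_def by blast
    qed (use H YB in auto)
    also have "\<dots> \<le> P.prob YB" using YB by (intro P.finite_measure_mono) auto
    finally show "\<eta> * P.prob (G n) \<le> P.prob YB" .
  qed
  have "incseq G"
  proof (rule incseq_SucI)
    fix n show "G n \<subseteq> G (Suc n)"
    proof
      fix \<omega> assume "\<omega> \<in> G n"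
      then obtain k where "\<omega> \<in> space M" "k \<le> 2^n" "X (real k * t1 / 2^n) \<omega> \<in> V" by (auto simp: G_def)
      then show "\<omega> \<in> G (Suc n)" unfolding G_def by (auto intro!: exI[of _ "2 * k"])
    qed
  qed
  then have "(\<lambda>n. P.prob (G n)) \<longlonglongrightarrow> P.prob (\<Union>n. G n)"
    using G by (intro P.finite_Lim_measure_incseq) auto
  then have "(\<lambda>n. \<eta> * P.prob (G n)) \<longlonglongrightarrow> \<eta> * P.prob (\<Union>n. G n)" by (intro tendsto_intros)
  then have lim: "\<eta> * P.prob (\<Union>n. G n) \<le> P.prob YB" by (rule LIMSEQ_le_const2) (auto intro: bound)
  have "{\<omega>\<in>space (P x). hitting_time X D \<omega> \<le> ennreal t1 \<and> R \<omega>} \<subseteq> (\<Union>n. G n)"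
  proof
    fix \<omega> assume "\<omega> \<in> {\<omega>\<in>space (P x). hitting_time X D \<omega> \<le> ennreal t1 \<and> R \<omega>}"
    then have \<omega>: "\<omega> \<in> space M" and hit: "hitting_time X D \<omega> \<le> ennreal t1" by (auto simp: P_space)
    obtain s where s: "s \<in> {0..t1}" "X s \<omega> \<in> D"
      using hitting_time_le_imp_hit[where X=X and \<omega>=\<omega> and D=D and t=t1]
        continuous_paths[OF \<omega>] compact_imp_closed[OF D] hit t1 by auto
    obtain d where d: "0 < d" "\<And>u. 0 \<le> u \<Longrightarrow> dist u s < d \<Longrightarrow> dist (X u \<omega>) (X s \<omega>) < \<delta>"
      using continuous_paths[OF \<omega>, unfolded continuous_on_iff, rule_format, of s \<delta>] s \<delta> by auto
    obtain n where n: "(1 / 2) ^ n < d / t1" using real_arch_pow_inv[of "d / t1" "1 / 2"] d t1 by auto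
    define k where "k = nat \<lfloor>s * 2^n / t1\<rfloor>"
    have sn: "0 \<le> s * 2^n / t1" "s * 2^n / t1 \<le> 2^n" using s t1 by (auto simp: field_simps)
    then have k: "real k \<le> s * 2^n / t1" "s * 2^n / t1 < real k + 1" unfolding k_def by linarith+
    have "real k \<le> 2^n" using k(1) sn(2) by linarith
    then have kn: "k \<le> 2^n" by (metis of_nat_le_iff of_nat_numeral of_nat_power)
    have "real k * t1 / 2^n \<le> s" "s < real k * t1 / 2^n + t1 / 2^n" using k t1 by (auto simp: field_simps)
    moreover have "t1 / 2^n < d" using n t1 by (simp add: field_simps power_divide)
    ultimately have "dist (real k * t1 / 2^n) s < d" by (simp add: dist_real_def)
    then have "dist (X (real k * t1 / 2^n) \<omega>) (X s \<omega>) < \<delta>" using t1 by (intro d) auto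
    then have "X (real k * t1 / 2^n) \<omega> \<in> V" unfolding V_def using s(2) by (intro UN_I[of "X s \<omega>"]) (auto simp: dist_commute)
    then show "\<omega> \<in> (\<Union>n. G n)" using \<omega> kn by (auto simp: G_def)
  qed
  then have "\<P>(\<omega> in P x. hitting_time X D \<omega> \<le> ennreal t1 \<and> R \<omega>) \<le> P.prob (\<Union>n. G n)"
    using G by (intro P.finite_measure_mono) auto
  then have "\<eta> * \<P>(\<omega> in P x. hitting_time X D \<omega> \<le> ennreal t1 \<and> R \<omega>) \<le> \<eta> * P.prob (\<Union>n. G n)"
    using \<eta> by (rule mult_left_mono)
  with lim show ?thesis unfolding YB_def using measure_K[of "2 * t1" B x] t1 B by simp
qed

end

section \<open>Exponential convergence of the conditional laws\<close>

text \<open>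
  The probability that the path stays in a ball during \<open>[t1, 2 * t1]\<close> is a lower bound, common to all
  \<open>s\<close> in that interval, for the probability of being in the ball at time \<open>s\<close>.
\<close>

lemma smoothing_kernels_of_process:
  fixes E :: "'a::metric_space set" and cem :: 'a
    and M :: "'w measure" and P :: "'a \<Rightarrow> 'w measure" and X :: "real \<Rightarrow> 'w \<Rightarrow> 'a"
  assumes process: "absorbed_strong_markov E cem M P X"
    and survival: "\<And>x t. x \<in> E \<Longrightarrow> 0 \<le> t \<Longrightarrow>
          \<P>(\<omega> in P x. ennreal t < absorption_time X cem \<omega>) > 0"
    and t1: "0 < t1" and C: "0 < C"
    and gradient: "\<And>f. f \<in> borel_measurable borel \<Longrightarrow> bounded (range f) \<Longrightarrow>
          gradient_norm (dirichlet_semigroup P X cem t1 f) \<le> ennreal (C * (SUP x. \<bar>f x\<bar>))"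
    and irreducible: "\<And>x y r. x \<in> E \<Longrightarrow> y \<in> E \<Longrightarrow> 0 < r \<Longrightarrow>
          \<P>(\<omega> in P x. \<forall>s\<in>{t1..2 * t1}. X s \<omega> \<in> ball y r) > 0"
  shows "smoothing_kernels E cem (absorbed_strong_markov.K P X) t1 C"
proof -
  interpret absorbed_strong_markov E cem M P X by (rule process)
  show ?thesis
  proof
    show "0 < S t x" if "x \<in> E" "0 \<le> t" for x t
      using survival[OF that] survival_event[OF P_space that(2), of x] measure_K[OF that(2) E_borel]
      by (simp add: S_def)
    show "\<exists>\<eta>>0. \<forall>s\<in>{t1..2 * t1}. \<eta> \<le> measure (K s x) (ball y r)"
      if xy: "x \<in> E" "y \<in> E" "0 < r" for x y and r :: real
    proof (intro exI conjI ballI)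
      show "0 < \<P>(\<omega> in P x. \<forall>s\<in>{t1..2 * t1}. X s \<omega> \<in> ball y r)" by (rule irreducible[OF xy])
      fix s assume s: "s \<in> {t1..2 * t1}"
      then have s0: "0 \<le> s" using t1 by simp
      interpret P: prob_space "P x" by (rule P_prob)
      have "\<P>(\<omega> in P x. \<forall>s\<in>{t1..2 * t1}. X s \<omega> \<in> ball y r) \<le> P.prob {\<omega>\<in>space M. X s \<omega> \<in> ball y r}"
        using s measurable_sets[OF X_measurable_P[OF s0, of x], of "ball y r"]
        by (intro P.finite_measure_mono) (auto simp: P_space vimage_def Int_def conj_commute)
      then show "\<P>(\<omega> in P x. \<forall>s\<in>{t1..2 * t1}. X s \<omega> \<in> ball y r) \<le> measure (K s x) (ball y r)"
        using measure_K[OF s0, of "ball y r" x] by simp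
    qed
    show "\<bar>U t1 f x - U t1 f y\<bar> \<le> C * b * dist x y"
      if f: "f \<in> borel_measurable borel" and f0: "\<And>z. 0 \<le> f z" and fb: "\<And>z. f z \<le> b" and fc: "f cem = 0"
      for f b x y
    proof (cases "x = y")
      case False
      have bnd: "bounded (range f)" using f0 fb by (intro boundedI[of _ b]) auto
      have "\<bar>f z\<bar> \<le> b" for z using f0[of z] fb[of z] by simp
      then have sup: "(SUP z. \<bar>f z\<bar>) \<le> b" by (intro cSUP_least) auto
      let ?g = "dirichlet_semigroup P X cem t1 f"
      have "ennreal (\<bar>?g x - ?g y\<bar> / dist x y) \<le> gradient_norm ?g"
        unfolding gradient_norm_def using False by (intro SUP_upper2[of "(x, y)"]) auto
      also have "\<dots> \<le> ennreal (C * (SUP z. \<bar>f z\<bar>))" by (rule gradient[OF f bnd])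
      also have "\<dots> \<le> ennreal (C * b)" using sup C by (intro ennreal_leI mult_left_mono) auto
      finally have "\<bar>?g x - ?g y\<bar> / dist x y \<le> C * b"
        using C order_trans[OF f0 fb] by (subst (asm) ennreal_le_iff) auto
      then show ?thesis
        using False dirichlet_semigroup_eq[OF less_imp_le[OF t1] f fc] by (simp add: pos_divide_le_eq)
    qed simp
  qed (use compact_space E_nonempty t1 C in auto)
qed

theorem theorem3p1:
  fixes E :: "'a::metric_space set" and cem :: 'a
    and M :: "'w measure" and P :: "'a \<Rightarrow> 'w measure" and X :: "real \<Rightarrow> 'w \<Rightarrow> 'a"
    and t1 :: real
  assumes process: "absorbed_strong_markov E cem M P X"
    and survival: "\<And>x t. x \<in> E \<Longrightarrow> 0 \<le> t \<Longrightarrow>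
          \<P>(\<omega> in P x. ennreal t < absorption_time X cem \<omega>) > 0"
    and t1: "0 < t1"
    and gradient: "\<exists>C>0. \<forall>f\<in>borel_measurable borel. bounded (range f) \<longrightarrow>
          gradient_norm (dirichlet_semigroup P X cem t1 f) \<le> ennreal (C * (SUP x. \<bar>f x\<bar>))"
    and return: "\<exists>K C'. K \<subseteq> E \<and> compact K \<and> 0 < C' \<and>
          (\<forall>x\<in>E. \<P>(\<omega> in P x. hitting_time X K \<omega> \<le> ennreal t1
                            \<and> ennreal t1 < absorption_time X cem \<omega>) \<ge> C' * dist x cem)"
    and irreducible: "\<And>x y r. x \<in> E \<Longrightarrow> y \<in> E \<Longrightarrow> 0 < r \<Longrightarrow>
          \<P>(\<omega> in P x. \<forall>s\<in>{t1..2 * t1}. X s \<omega> \<in> ball y r) > 0"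
  shows "condition_A E cem P X \<and>
    (\<exists>\<alpha> B0 \<gamma>0. prob_measure_on E \<alpha> \<and> 0 < B0 \<and> 0 < \<gamma>0 \<and>
       (\<forall>\<mu>. prob_measure_on E \<mu> \<longrightarrow> (\<forall>t\<ge>0.
          tv_norm (\<lambda>A. conditional_law (\<mu> \<bind> P) X cem t A - measure \<alpha> A)
            \<le> B0 * exp (- \<gamma>0 * t)))) \<and>
    (\<exists>B \<gamma>. 0 < B \<and> 0 < \<gamma> \<and>
       (\<forall>\<mu>1 \<mu>2. prob_measure_on E \<mu>1 \<longrightarrow> prob_measure_on E \<mu>2 \<longrightarrow> (\<forall>t\<ge>0.
          tv_norm (\<lambda>A. conditional_law (\<mu>1 \<bind> P) X cem t A - conditional_law (\<mu>2 \<bind> P) X cem t A)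
            \<le> B * exp (- \<gamma> * t) / max (\<integral>x. dist x cem \<partial>\<mu>1) (\<integral>x. dist x cem \<partial>\<mu>2)
               * tv_norm (\<lambda>A. measure \<mu>1 A - measure \<mu>2 A))))"
proof -
  interpret absorbed_strong_markov E cem M P X by (rule process)
  obtain C where C: "0 < C"
    and grad: "\<And>f. f \<in> borel_measurable borel \<Longrightarrow> bounded (range f) \<Longrightarrow>
      gradient_norm (dirichlet_semigroup P X cem t1 f) \<le> ennreal (C * (SUP x. \<bar>f x\<bar>))"
    using gradient by blast
  interpret smoothing_kernels E cem K t1 C
    by (rule smoothing_kernels_of_process[OF process survival t1 C grad irreducible])
  obtain D C' where D: "D \<subseteq> E" "compact D" and C': "0 < C'"
    and hit: "\<And>x. x \<in> E \<Longrightarrow> C' * dist x cem \<le>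
      \<P>(\<omega> in P x. hitting_time X D \<omega> \<le> ennreal t1 \<and> ennreal t1 < absorption_time X cem \<omega>)"
    using return by blast
  obtain x0 where x0: "x0 \<in> E" using E_nonempty by blast
  have "\<exists>k>0. \<forall>x\<in>E. k * dist x cem \<le> measure (K (2 * t1) x) (ball x0 r)" if r: "0 < r" for r
  proof -
    obtain \<eta> \<delta> where \<eta>: "0 < \<eta>" and \<delta>: "0 < \<delta>"
      and reach: "\<And>s x z. s \<in> {t1..2 * t1} \<Longrightarrow> x \<in> D \<Longrightarrow> z \<in> ball x \<delta> \<Longrightarrow> \<eta> \<le> measure (K s z) (ball x0 r)"
      using uniformly_reachable[OF D(2,1) x0 r] by blast
    have "\<eta> * C' * dist x cem \<le> measure (K (2 * t1) x) (ball x0 r)" if x: "x \<in> E" for x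
    proof -
      have "\<eta> * (C' * dist x cem) \<le>
          \<eta> * \<P>(\<omega> in P x. hitting_time X D \<omega> \<le> ennreal t1 \<and> ennreal t1 < absorption_time X cem \<omega>)"
        using hit[OF x] \<eta> by (intro mult_left_mono) auto
      also have "\<dots> \<le> measure (K (2 * t1) x) (ball x0 r)"
        using \<eta> by (intro hit_then_reach[OF D(2) t1 \<delta>] reach) auto
      finally show ?thesis by (simp add: mult.assoc)
    qed
    then show ?thesis using \<eta> C' by (intro exI[of _ "\<eta> * C'"]) auto
  qed
  then obtain a \<nu> where a: "0 < a" and \<nu>: "prob_measure_on E \<nu>"
    and minor: "\<And>x A. x \<in> E \<Longrightarrow> A \<in> sets borel \<Longrightarrow> a * dist x cem * measure \<nu> A \<le> measure (K (4 * t1) x) A"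
    using minorization_by_distance[OF x0] by blast
  obtain c2 where "conditioned_kernels E cem K (4 * t1) (a / C) c2 \<nu>"
    using conditioned_kernels_of_minorization[OF a \<nu> minor] by blast
  then interpret cond: conditioned_kernels E cem K "4 * t1" "a / C" c2 \<nu> .
  have law: "conditional_law (\<mu> \<bind> P) X cem t A = cond.\<Phi> \<mu> t A"
    if "prob_measure_on E \<mu>" "0 \<le> t" "A \<in> sets borel" for \<mu> t A
    unfolding conditional_law_eq[OF bind_P(1)[OF that(1)] that(2)] cond.\<Phi>_def S_def[abs_def]
      bind_P(2)[OF that(1,2) sets.Int[OF that(3) E_borel]] bind_P(2)[OF that(1,2) E_borel] ..
  have law_measure: "\<exists>N. prob_measure_on E N \<and> (\<forall>A\<in>sets borel. conditional_law (\<mu> \<bind> P) X cem t A = measure N A)"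
    if \<mu>: "prob_measure_on E \<mu>" and t: "0 \<le> t" for \<mu> t
    using cond.\<Phi>_is_measure[OF that] law[OF \<mu> t] by simp
  obtain \<gamma> where \<gamma>: "0 < \<gamma>" and rate: "\<And>t. 0 \<le> t \<Longrightarrow> cond.\<epsilon> t \<le> 2 * exp (- \<gamma> * t)"
    using cond.\<epsilon>_exponential by blast

  have A: "condition_A E cem P X"
    unfolding condition_A_def
  proof (intro exI conjI ballI allI impI)
    show "0 < 4 * t1" "0 < a / C" "0 < c2" "prob_measure_on E \<nu>"
      using t1 a C cond.c2 \<nu> by auto
    fix x A assume x: "x \<in> E" and A: "A \<in> sets (borel :: 'a measure)"
    have t: "0 \<le> 4 * t1" using t1 by simp
    interpret \<nu>: prob_space \<nu> by (rule cond.\<nu>_prob)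
    have "AE y in \<nu>. y \<in> E" using cond.\<nu>_E cond.\<nu>_sets by (intro \<nu>.AE_in_set_eq_1[THEN iffD2]) auto
    then have "measure \<nu> A = measure \<nu> (A \<inter> E)"
      using A cond.\<nu>_sets by (intro \<nu>.finite_measure_eq_AE) (auto elim: eventually_mono)
    moreover have "a / C * S (4 * t1) x * measure \<nu> (A \<inter> E) \<le> measure (K (4 * t1) x) (A \<inter> E)"
      using A by (intro cond.A1 x) auto
    moreover have "conditional_law (P x) X cem (4 * t1) A = measure (K (4 * t1) x) (A \<inter> E) / S (4 * t1) x"
      using conditional_law_eq[OF P_space t, of x A] measure_K[OF t] A by (simp add: S_def)
    ultimately show "a / C * measure \<nu> A \<le> conditional_law (P x) X cem (4 * t1) A"
      using cond.S_pos[OF x t] by (simp add: pos_le_divide_eq mult_ac)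
  next
    fix z and t :: real assume z: "z \<in> E" and t: "0 \<le> t"
    show "c2 * \<P>(\<omega> in P z. ennreal t < absorption_time X cem \<omega>)
        \<le> \<P>(\<omega> in \<nu> \<bind> P. ennreal t < absorption_time X cem \<omega>)"
      using cond.A2[OF t, of z] survival_event[OF P_space t, of z] survival_event[OF bind_P(1)[OF \<nu>] t]
        bind_P(2)[OF \<nu> t E_borel] measure_K[OF t E_borel]
      by (simp add: S_def[abs_def])
  qed

  obtain \<alpha> where \<alpha>: "prob_measure_on E \<alpha>"
    and conv: "\<And>\<mu> t A. prob_measure_on E \<mu> \<Longrightarrow> 0 \<le> t \<Longrightarrow> A \<in> sets borel \<Longrightarrow>
      \<bar>cond.\<Phi> \<mu> t A - measure \<alpha> A\<bar> \<le> 2 * cond.\<epsilon> t"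
    using cond.quasi_stationary_limit by blast
  have limit: "tv_norm (\<lambda>A. conditional_law (\<mu> \<bind> P) X cem t A - measure \<alpha> A) \<le> 8 * exp (- \<gamma> * t)"
    if \<mu>: "prob_measure_on E \<mu>" and t: "0 \<le> t" for \<mu> t
  proof -
    obtain N where N: "prob_measure_on E N" "\<And>A. A \<in> sets borel \<Longrightarrow> conditional_law (\<mu> \<bind> P) X cem t A = measure N A"
      using law_measure[OF \<mu> t] by blast
    have "tv_norm (\<lambda>A. conditional_law (\<mu> \<bind> P) X cem t A - measure \<alpha> A) \<le> 2 * (4 * exp (- \<gamma> * t))"
    proof (rule tv_norm_le[of N \<alpha>])
      show "\<bar>conditional_law (\<mu> \<bind> P) X cem t A - measure \<alpha> A\<bar> \<le> 4 * exp (- \<gamma> * t)" if "A \<in> sets borel" for A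
        using conv[OF \<mu> t that] rate[OF t] law[OF \<mu> t that] by simp
    qed (use N \<alpha> in \<open>auto simp: prob_measure_on_def\<close>)
    then show ?thesis by simp
  qed

  \<comment> \<open>One factor \<open>2\<close> each comes from \<open>\<Phi>_diff_lipschitz\<close>, from the exponential bound on \<open>\<epsilon>\<close> and from
    the passage from single sets to the total variation norm.\<close>
  define B where "B = 8 / (a * c2)"
  have B: "0 < B" unfolding B_def using a cond.c2 by simp
  have contract: "tv_norm (\<lambda>A. conditional_law (\<mu>1 \<bind> P) X cem t A - conditional_law (\<mu>2 \<bind> P) X cem t A)
      \<le> B * exp (- \<gamma> * t) / max (\<integral>x. dist x cem \<partial>\<mu>1) (\<integral>x. dist x cem \<partial>\<mu>2)
         * tv_norm (\<lambda>A. measure \<mu>1 A - measure \<mu>2 A)"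
    if \<mu>1: "prob_measure_on E \<mu>1" and \<mu>2: "prob_measure_on E \<mu>2" and t: "0 \<le> t" for \<mu>1 \<mu>2 t
  proof -
    let ?r = "\<lambda>\<mu>. \<integral>x. dist x cem \<partial>\<mu>"
    define d where "d = tv_norm (\<lambda>A. measure \<mu>1 A - measure \<mu>2 A)"
    have d: "\<bar>measure \<mu>1 A - measure \<mu>2 A\<bar> \<le> d" if "A \<in> sets borel" for A
      unfolding d_def using \<mu>1 \<mu>2 that by (intro abs_le_tv_norm[of \<mu>1 \<mu>2]) (auto simp: prob_measure_on_def)
    have d0: "0 \<le> d" using d[of "{}"] by simp
    obtain N1 where N1: "prob_measure_on E N1" "\<And>A. A \<in> sets borel \<Longrightarrow> conditional_law (\<mu>1 \<bind> P) X cem t A = measure N1 A"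
      using law_measure[OF \<mu>1 t] by blast
    obtain N2 where N2: "prob_measure_on E N2" "\<And>A. A \<in> sets borel \<Longrightarrow> conditional_law (\<mu>2 \<bind> P) X cem t A = measure N2 A"
      using law_measure[OF \<mu>2 t] by blast
    have "\<bar>cond.\<Phi> \<mu>1 t A - cond.\<Phi> \<mu>2 t A\<bar> \<le> 2 * cond.\<epsilon> t * d / (a * c2 * max (?r \<mu>1) (?r \<mu>2))"
      if A: "A \<in> sets borel" for A
    proof (cases "?r \<mu>2 \<le> ?r \<mu>1")
      case True
      have "\<bar>cond.\<Phi> \<mu>1 t A - cond.\<Phi> \<mu>2 t A\<bar> \<le> 2 * cond.\<epsilon> t * d / (a * c2 * ?r \<mu>1)"
        using integrable_dist[OF \<mu>1] d by (intro cond.\<Phi>_diff_lipschitz[OF a minor] \<mu>1 \<mu>2 t A) auto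
      then show ?thesis using True by (simp add: max_absorb1)
    next
      case False
      have "\<bar>cond.\<Phi> \<mu>2 t A - cond.\<Phi> \<mu>1 t A\<bar> \<le> 2 * cond.\<epsilon> t * d / (a * c2 * ?r \<mu>2)"
        using integrable_dist[OF \<mu>2] d
        by (intro cond.\<Phi>_diff_lipschitz[OF a minor] \<mu>1 \<mu>2 t A) (auto simp: abs_minus_commute)
      then show ?thesis using False by (simp add: max_absorb2 abs_minus_commute)
    qed
    also have "2 * cond.\<epsilon> t * d / (a * c2 * max (?r \<mu>1) (?r \<mu>2))
        \<le> 2 * (2 * exp (- \<gamma> * t)) * d / (a * c2 * max (?r \<mu>1) (?r \<mu>2))"
      using rate[OF t] d0 a cond.c2 integrable_dist(2)[OF \<mu>1]
      by (intro divide_right_mono mult_right_mono mult_left_mono mult_nonneg_nonneg) (auto simp: le_max_iff_disj)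
    finally have "\<bar>cond.\<Phi> \<mu>1 t A - cond.\<Phi> \<mu>2 t A\<bar>
        \<le> 2 * (2 * exp (- \<gamma> * t)) * d / (a * c2 * max (?r \<mu>1) (?r \<mu>2))" if "A \<in> sets borel" for A
      using that by blast
    then have "tv_norm (\<lambda>A. conditional_law (\<mu>1 \<bind> P) X cem t A - conditional_law (\<mu>2 \<bind> P) X cem t A)
        \<le> 2 * (2 * (2 * exp (- \<gamma> * t)) * d / (a * c2 * max (?r \<mu>1) (?r \<mu>2)))"
      using N1 N2 law[OF \<mu>1 t] law[OF \<mu>2 t]
      by (intro tv_norm_le[of N1 N2]) (auto simp: prob_measure_on_def)
    also have "\<dots> = B * exp (- \<gamma> * t) / max (?r \<mu>1) (?r \<mu>2) * d" by (simp add: B_def)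
    finally show ?thesis unfolding d_def .
  qed
  show ?thesis
  proof (intro conjI)
    show "\<exists>\<alpha> B0 \<gamma>0. prob_measure_on E \<alpha> \<and> 0 < B0 \<and> 0 < \<gamma>0 \<and>
       (\<forall>\<mu>. prob_measure_on E \<mu> \<longrightarrow> (\<forall>t\<ge>0.
          tv_norm (\<lambda>A. conditional_law (\<mu> \<bind> P) X cem t A - measure \<alpha> A) \<le> B0 * exp (- \<gamma>0 * t)))"
      using \<alpha> \<gamma> limit by (intro exI[of _ \<alpha>] exI[of _ 8] exI[of _ \<gamma>]) auto
    show "\<exists>B \<gamma>. 0 < B \<and> 0 < \<gamma> \<and>
       (\<forall>\<mu>1 \<mu>2. prob_measure_on E \<mu>1 \<longrightarrow> prob_measure_on E \<mu>2 \<longrightarrow> (\<forall>t\<ge>0.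
          tv_norm (\<lambda>A. conditional_law (\<mu>1 \<bind> P) X cem t A - conditional_law (\<mu>2 \<bind> P) X cem t A)
            \<le> B * exp (- \<gamma> * t) / max (\<integral>x. dist x cem \<partial>\<mu>1) (\<integral>x. dist x cem \<partial>\<mu>2)
               * tv_norm (\<lambda>A. measure \<mu>1 A - measure \<mu>2 A)))"
      using B \<gamma> contract by blast
  qed (rule A)
qed

end
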